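(* Let $N$ be a finite-dimensional $\mathbb{C}$-algebra, let $A$ be a semisimple $\mathbb{C}$-algebra of the same dimension as $N$, and let $\mathcal{N}=N\{t\}$ be a strongly flat deformation from $N$ to $A$. Then there is a real number $\delta>0$ such that for all real numbers $s$ with $0<s<\delta$ the specialisation $N_s$ of $\mathcal{N}$ at $t=s$ is isomorphic to $A$ as a $\mathbb{C}$-algebra. In particular, if $\mathcal{N}$ is also a strongly flat deformation from $N$ to a semisimple $\mathbb{C}$-algebra $B$, then $A$ and $B$ are isomorphic $\mathbb{C}$-algebras.
   Context: All algebras are associative with identity, usually noncommutative. $\mathbb{C}\{t\}$ denotes the ring of power series in $t$ with coefficients in $\mathbb{C}$, and for a finite-dimensional $\mathbb{C}$-algebra $N$, $N\{t\}$ denotes the set of power series in $t$ with coefficients in $N$, with its natural $\mathbb{C}\{t\}$-module structure. Formal deformation: a formal deformation $\mathcal{N}=N\{t\}$ of $N$ is an associative $\mathbb{C}\{t\}$-bilinear multiplication $\circ_t$ on $N\{t\}$ such that for $a,b\in N$ the constant term (coefficient of $t^0$) of $a\circ_t b$ is the product $ab$ in $N$, and such that the identity element of $N$ acts as the identity of $N\{t\}$. Specialisation: let $d_1,\dots,d_n$ be a basis of $N$ over $\mathbb{C}$ and write $d_i\circ_t d_j=\sum_{l=1}^n g_{i,j,l}(t)\,d_l$ with $g_{i,j,l}(t)\in\mathbb{C}\{t\}$. If all $g_{i,j,l}$ converge at $t=s$, the specialisation $N_s$ of $\mathcal{N}$ at $t=s$ is the $\mathbb{C}$-algebra with basis $d_1,\dots,d_n$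 and multiplication $d_i\circ_s d_j=\sum_l g_{i,j,l}(s)\,d_l$. Thus $N_0=N$. Strongly flat deformation: let $N$ and $B$ be finite-dimensional $\mathbb{C}$-algebras of the same dimension. A formal deformation $\mathcal{N}$ of $N$ is a strongly flat deformation from $N$ to $B$ if (1) there is a real $c>0$ such that all $g_{i,j,l}(t)$ converge for $t\in[0,c)$ (so $N_s$ is defined for all $s\in[0,c)$), and $N_{t_0}\cong B$ for some $t_0\in(0,c)$; and (2) for every real $\epsilon>0$ there is $s$ with $0<s<\epsilon$ such that $N_s\cong B$. *)

theory Defs
  imports "HOL-Analysis.Analysis"
begin

text \<open>The additive group of an algebra comes from its type. The remaining operations are
  collected in a record, since a deformation puts many products on one vector space.\<close>

record 'a calg =
  alg_scale :: "complex \<Rightarrow> 'a \<Rightarrow> 'a"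
  alg_mult :: "'a \<Rightarrow> 'a \<Rightarrow> 'a"
  alg_one :: 'a

locale complex_algebra = vector_space "alg_scale A"
  for A :: "('a::ab_group_add) calg" +
  assumes mult_assoc: "alg_mult A (alg_mult A x y) z = alg_mult A x (alg_mult A y z)"
    and mult_add_left: "alg_mult A (x + y) z = alg_mult A x z + alg_mult A y z"
    and mult_add_right: "alg_mult A x (y + z) = alg_mult A x y + alg_mult A x z"
    and mult_scale_left: "alg_mult A (alg_scale A c x) y = alg_scale A c (alg_mult A x y)"
    and mult_scale_right: "alg_mult A x (alg_scale A c y) = alg_scale A c (alg_mult A x y)"
    and mult_one_left: "alg_mult A (alg_one A) x = x"
    and mult_one_right: "alg_mult A x (alg_one A) = x"

text \<open>Finite-dimensionality has to be required separately: \<open>dim\<close> takes the value 0 on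
  infinite-dimensional spaces.\<close>

definition fin_dim_algebra :: "('a::ab_group_add) calg \<Rightarrow> bool" where
  "fin_dim_algebra A \<longleftrightarrow>
     complex_algebra A \<and> (\<exists>D. finite_dimensional_vector_space (alg_scale A) D)"

definition alg_dim :: "('a::ab_group_add) calg \<Rightarrow> nat" where
  "alg_dim A = vector_space.dim (alg_scale A) UNIV"

definition alg_isomorphic :: "('a::ab_group_add) calg \<Rightarrow> ('b::ab_group_add) calg \<Rightarrow> bool" where
  "alg_isomorphic A B \<longleftrightarrow>
     (\<exists>\<phi>. Vector_Spaces.linear (alg_scale A) (alg_scale B) \<phi> \<and> bij \<phi> \<and>
          (\<forall>x y. \<phi> (alg_mult A x y) = alg_mult B (\<phi> x) (\<phi> y)) \<and>
          \<phi> (alg_one A) = alg_one B)"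

text \<open>Closure under scalars and negation is automatic for left ideals of a unital algebra.\<close>

definition left_ideal :: "('a::ab_group_add) calg \<Rightarrow> 'a set \<Rightarrow> bool" where
  "left_ideal A L \<longleftrightarrow>
     0 \<in> L \<and> (\<forall>x\<in>L. \<forall>y\<in>L. x + y \<in> L) \<and> (\<forall>a. \<forall>x\<in>L. alg_mult A a x \<in> L)"

text \<open>The left regular module is semisimple: each of its submodules is a direct summand.\<close>

definition semisimple_algebra :: "('a::ab_group_add) calg \<Rightarrow> bool" where
  "semisimple_algebra A \<longleftrightarrow>
     (\<forall>L. left_ideal A L \<longrightarrow>
        (\<exists>L'. left_ideal A L' \<and> L \<inter> L' = {0} \<and> {x + y |x y. x \<in> L \<and> y \<in> L'} = UNIV))"

text \<open>\<open>N{t}\<close> is the type \<open>'a fps\<close>, with \<open>fps_const\<close> as the inclusion of \<open>N\<close>; its module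
  structure over \<open>complex fps\<close> is the Cauchy product.\<close>

definition fps_scale ::
    "(complex \<Rightarrow> 'a \<Rightarrow> 'a) \<Rightarrow> complex fps \<Rightarrow> ('a::ab_group_add) fps \<Rightarrow> 'a fps" where
  "fps_scale sc f x = Abs_fps (\<lambda>k. \<Sum>i=0..k. sc (fps_nth f i) (fps_nth x (k - i)))"

locale formal_deformation = complex_algebra N
  for N :: "('a::ab_group_add) calg" +
  fixes circ :: "'a fps \<Rightarrow> 'a fps \<Rightarrow> 'a fps"
  assumes circ_assoc: "circ (circ x y) z = circ x (circ y z)"
    and circ_add_left: "circ (x + y) z = circ x z + circ y z"
    and circ_add_right: "circ x (y + z) = circ x y + circ x z"
    and circ_scale_left:
      "circ (fps_scale (alg_scale N) f x) y = fps_scale (alg_scale N) f (circ x y)"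
    and circ_scale_right:
      "circ x (fps_scale (alg_scale N) f y) = fps_scale (alg_scale N) f (circ x y)"
    and circ_constant_term: "fps_nth (circ (fps_const a) (fps_const b)) 0 = alg_mult N a b"
    and circ_one_left: "circ (fps_const (alg_one N)) x = x"
    and circ_one_right: "circ x (fps_const (alg_one N)) = x"

text \<open>For a finite basis \<open>D\<close> and \<open>i, j, l \<in> D\<close>, the power series \<open>g\<^bsub>i,j,l\<^esub>(t)\<close>, obtained by
  expanding each coefficient of \<open>i \<circ>\<^sub>t j\<close> in the basis.\<close>

definition struct_coeff ::
    "('a::ab_group_add) calg \<Rightarrow> 'a set \<Rightarrow> ('a fps \<Rightarrow> 'a fps \<Rightarrow> 'a fps) \<Rightarrow> 'a \<Rightarrow> 'a \<Rightarrow> 'a \<Rightarrow> complex fps"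
  where
  "struct_coeff N D circ i j l =
     Abs_fps (\<lambda>k. module.representation (alg_scale N) D
                     (fps_nth (circ (fps_const i) (fps_const j)) k) l)"

definition struct_coeffs_converge ::
    "('a::ab_group_add) calg \<Rightarrow> 'a set \<Rightarrow> ('a fps \<Rightarrow> 'a fps \<Rightarrow> 'a fps) \<Rightarrow> complex \<Rightarrow> bool"
  where
  "struct_coeffs_converge N D circ s \<longleftrightarrow>
     (\<forall>i\<in>D. \<forall>j\<in>D. \<forall>l\<in>D. summable (\<lambda>k. fps_nth (struct_coeff N D circ i j l) k * s ^ k))"

text \<open>\<open>N\<^sub>s\<close>, realised on the vector space of \<open>N\<close>, with the product that is bilinear and given on
  \<open>D\<close> by the values \<open>g\<^bsub>i,j,l\<^esub>(s)\<close>. Meaningful only if the structure coefficients converge at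
  \<open>s\<close>.\<close>

definition specialisation ::
    "('a::ab_group_add) calg \<Rightarrow> 'a set \<Rightarrow> ('a fps \<Rightarrow> 'a fps \<Rightarrow> 'a fps) \<Rightarrow> complex \<Rightarrow> 'a calg"
  where
  "specialisation N D circ s =
     \<lparr> alg_scale = alg_scale N,
       alg_mult = (\<lambda>x y. \<Sum>i\<in>D. \<Sum>j\<in>D. \<Sum>l\<in>D.
          alg_scale N
            (module.representation (alg_scale N) D x i *
             module.representation (alg_scale N) D y j *
             eval_fps (struct_coeff N D circ i j l) s) l),
       alg_one = alg_one N \<rparr>"

text \<open>\<open>D\<close> is the basis of \<open>N\<close> with respect to which specialisations are formed.\<close>

definition strongly_flat_deformation ::
    "('a::ab_group_add) calg \<Rightarrow> 'a set \<Rightarrow> ('a fps \<Rightarrow> 'a fps \<Rightarrow> 'a fps) \<Rightarrow>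
     ('b::ab_group_add) calg \<Rightarrow> bool"
  where
  "strongly_flat_deformation N D circ B \<longleftrightarrow>
     fin_dim_algebra N \<and> fin_dim_algebra B \<and> alg_dim N = alg_dim B \<and>
     finite_dimensional_vector_space (alg_scale N) D \<and>
     formal_deformation N circ \<and>
     (\<exists>c::real. c > 0 \<and>
        (\<forall>s::real. 0 \<le> s \<and> s < c \<longrightarrow> struct_coeffs_converge N D circ (of_real s)) \<and>
        (\<exists>t0::real. 0 < t0 \<and> t0 < c \<and>
           alg_isomorphic (specialisation N D circ (of_real t0)) B)) \<and>
     (\<forall>\<epsilon>::real. \<epsilon> > 0 \<longrightarrow>
        (\<exists>s::real. 0 < s \<and> s < \<epsilon> \<and> struct_coeffs_converge N D circ (of_real s) \<and>
           alg_isomorphic (specialisation N D circ (of_real s)) B))"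

lemma circ_basis_expansion:
  assumes "finite_dimensional_vector_space (alg_scale N) D"
  shows "circ (fps_const i) (fps_const j) =
    (\<Sum>l\<in>D. fps_scale (alg_scale N) (struct_coeff N D circ i j l) (fps_const l))"
proof (rule fps_ext)
  fix k
  interpret finite_dimensional_vector_space "alg_scale N" D by fact
  let ?v = "fps_nth (circ (fps_const i) (fps_const j)) k"
  have "fps_nth (fps_scale (alg_scale N) f (fps_const l)) k = alg_scale N (fps_nth f k) l" for f l
  proof -
    have "(\<Sum>m=0..k. alg_scale N (fps_nth f m) (fps_nth (fps_const l) (k - m)))
        = (\<Sum>m=0..k. if m = k then alg_scale N (fps_nth f k) l else 0)"
      by (rule sum.cong) auto
    then show ?thesis by (simp add: fps_scale_def)
  qed
  then have "fps_nth (\<Sum>l\<in>D. fps_scale (alg_scale N) (struct_coeff N D circ i j l) (fps_const l)) k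
      = (\<Sum>l\<in>D. alg_scale N (representation D ?v l) l)"
    by (simp add: fps_sum_nth struct_coeff_def)
  also have "\<dots> = ?v"
    by (rule sum_representation_eq) (auto simp: independent_Basis span_Basis finite_Basis)
  finally show "?v =
      fps_nth (\<Sum>l\<in>D. fps_scale (alg_scale N) (struct_coeff N D circ i j l) (fps_const l)) k"
    by simp
qed

lemma specialisation_mult_basis:
  assumes "finite_dimensional_vector_space (alg_scale N) D" and "i \<in> D" and "j \<in> D"
  shows "alg_mult (specialisation N D circ s) i j =
    (\<Sum>l\<in>D. alg_scale N (eval_fps (struct_coeff N D circ i j l) s) l)"
proof -
  interpret finite_dimensional_vector_space "alg_scale N" D by fact
  have *: "(\<Sum>j'\<in>D. \<Sum>l\<in>D. alg_scale N (representation D i i' * representation D j j' *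
            eval_fps (struct_coeff N D circ i' j' l) s) l)
     = (if i' = i then \<Sum>l\<in>D. alg_scale N (eval_fps (struct_coeff N D circ i j l) s) l else 0)"
    for i'
  proof -
    have "(\<Sum>j'\<in>D. \<Sum>l\<in>D. alg_scale N (representation D i i' * representation D j j' *
            eval_fps (struct_coeff N D circ i' j' l) s) l)
      = (\<Sum>j'\<in>D. if j' = j then (if i' = i then
           \<Sum>l\<in>D. alg_scale N (eval_fps (struct_coeff N D circ i j l) s) l else 0) else 0)"
      by (rule sum.cong) (auto simp: representation_basis[OF independent_Basis] assms)
    then show ?thesis using assms finite_Basis by simp
  qed
  show ?thesis
    unfolding specialisation_def calg.simps * using assms finite_Basis by simp
qed

end

theory Submission
  imports Defs "HOL-Complex_Analysis.Complex_Analysis" "Jordan_Normal_Form.Determinant"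
begin

text \<open>The specialisations \<open>N\<^sub>s\<close> form a family of algebra structures on one vector space whose structure
  constants are holomorphic on a disc around 0. For an algebra over the complex numbers, semisimplicity
  forces the trace form \<open>(x, y) \<mapsto> tr L\<^bsub>xy\<^esub>\<close> of the regular representation to be nondegenerate
  (lemma \<open>semisimple_imp_nondegenerate_trace_form\<close>). The determinant of this form is a holomorphic
  function of \<open>s\<close>. It does not vanish identically, because some fibre is isomorphic to the semisimple
  algebra \<open>A\<close>; as zeros of holomorphic functions are isolated, it has no zero in some interval
  \<open>(0, \<delta>)\<close>. So every \<open>N\<^sub>s\<close> with \<open>0 < s < \<delta>\<close> has a nondegenerate trace form.

  Where the trace form is nondegenerate, the isomorphism type is locally constant
  (lemma \<open>local_triviality\<close>). Let \<open>m\<^sub>s\<close> be the product of the family. Differentiating the associative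
  law shows that the derivative \<open>m'\<^sub>s\<close> is a Hochschild 2-cocycle. The Casimir element
  \<open>\<Sum>\<^sub>i d\<^sub>i \<otimes> d\<^sup>i\<close> of the trace form is a separability idempotent, so the cocycle is the coboundary of
  the explicit map \<open>f\<^sub>s x = \<Sum>\<^sub>i d\<^sub>i \<cdot> m'\<^sub>s(d\<^sup>i, x)\<close>, which depends holomorphically on \<open>s\<close>
  (lemma \<open>cocycle_splits\<close>). Transport along the linear differential equation \<open>X' = - f\<^sub>s X\<close> then
  carries the product at one parameter to the product at nearby parameters, since \<open>m\<^sub>s(X, Y)\<close>
  solves the equation whenever \<open>X\<close> and \<open>Y\<close> do.

  As \<open>(0, \<delta>)\<close> is connected, all \<open>N\<^sub>s\<close> with \<open>0 < s < \<delta>\<close> are isomorphic, and \<open>A\<close> is among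
  them because \<open>N\<^sub>s \<cong> A\<close> for arbitrarily small \<open>s\<close>. A second algebra \<open>B\<close> is isomorphic to some
  \<open>N\<^sub>s\<close> in the same interval, hence to \<open>A\<close>.\<close>

section \<open>Coordinates with respect to a basis\<close>

locale coordinate_space = finite_dimensional_vector_space scale D
  for scale :: "complex \<Rightarrow> 'v::ab_group_add \<Rightarrow> 'v" and D :: "'v set"
begin

abbreviation coord :: "'v \<Rightarrow> 'v \<Rightarrow> complex" where "coord \<equiv> representation D"

lemma in_span_D [simp]: "v \<in> span D"
  by (simp add: span_Basis)

lemma coord_simps [simp]:
  "coord 0 i = 0" "coord (- u) i = - coord u i"
  "coord (u + v) i = coord u i + coord v i" "coord (u - v) i = coord u i - coord v i"
  "coord (scale c u) i = c * coord u i"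
  by (simp_all add: representation_zero representation_neg representation_add
        representation_diff representation_scale independent_Basis)

lemma coord_sum [simp]: "coord (\<Sum>k\<in>K. f k) i = (\<Sum>k\<in>K. coord (f k) i)"
  by (subst representation_sum) (simp_all add: independent_Basis)

lemma coord_basis: "i \<in> D \<Longrightarrow> coord i j = (if j = i then 1 else 0)"
  by (simp add: representation_basis independent_Basis)

lemma coord_expansion: "(\<Sum>i\<in>D. scale (coord v i) i) = v"
  by (rule sum_representation_eq) (simp_all add: independent_Basis finite_Basis)

lemma coord_combination: "i \<in> D \<Longrightarrow> coord (\<Sum>j\<in>D. scale (c j) j) i = c i"
  by (simp add: coord_basis finite_Basis if_distrib cong: if_cong)

lemma coord_eqI:
  assumes "\<And>i. i \<in> D \<Longrightarrow> coord u i = coord v i"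
  shows "u = v"
proof -
  have "(\<Sum>i\<in>D. scale (coord u i) i) = (\<Sum>i\<in>D. scale (coord v i) i)"
    using assms by simp
  then show ?thesis by (simp add: coord_expansion)
qed

text \<open>The target carries an arbitrary scaling function, so that the same rule serves for linear maps
  into the space (with \<open>scale\<close>) and for linear functionals (with multiplication).\<close>

lemma linear_expansion:
  fixes f :: "'v \<Rightarrow> 'b::ab_group_add"
  assumes "\<And>x y. f (x + y) = f x + f y" and "\<And>c x. f (scale c x) = sc (c::complex) (f x)"
  shows "f v = (\<Sum>i\<in>D. sc (coord v i) (f i))"
proof -
  have f0: "f 0 = 0" using assms(1)[of 0 0] by simp
  have "f (\<Sum>i\<in>K. scale (coord v i) i) = (\<Sum>i\<in>K. sc (coord v i) (f i))" if "finite K" for K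
    using that by induction (simp_all add: f0 assms)
  from this[OF finite_Basis] show ?thesis by (simp add: coord_expansion)
qed

end

section \<open>The regular trace form and its Casimir element\<close>

locale based_algebra = complex_algebra A + coordinate_space "alg_scale A" D
  for A :: "'v::ab_group_add calg" and D :: "'v set"
begin

abbreviation amult (infixl "\<star>" 70) where "x \<star> y \<equiv> alg_mult A x y"

lemma mult_zero [simp]: "0 \<star> x = 0" "x \<star> 0 = 0"
  using mult_add_left[of 0 0 x] mult_add_right[of x 0 0] by simp_all

lemma mult_minus [simp]: "(- x) \<star> y = - (x \<star> y)" "x \<star> (- y) = - (x \<star> y)"
  using mult_add_left[of x "- x" y] mult_add_right[of x y "- y"]
  by (simp_all add: eq_neg_iff_add_eq_0 add.commute)

lemma mult_diff: "(x - y) \<star> z = x \<star> z - y \<star> z" "z \<star> (x - y) = z \<star> x - z \<star> y"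
  using mult_add_left[of x "- y" z] mult_add_right[of z x "- y"] by simp_all

lemma mult_sum: "(\<Sum>i\<in>K. f i) \<star> y = (\<Sum>i\<in>K. f i \<star> y)" "y \<star> (\<Sum>i\<in>K. f i) = (\<Sum>i\<in>K. y \<star> f i)"
  by (induction K rule: infinite_finite_induct; simp add: mult_add_left mult_add_right)+

text \<open>The trace of left multiplication by \<open>x\<close>, read off from the diagonal of its matrix in the
  basis \<open>D\<close>.\<close>

definition reg_trace :: "'v \<Rightarrow> complex" where
  "reg_trace x = (\<Sum>k\<in>D. coord (x \<star> k) k)"

lemma reg_trace_linear [simp]:
  "reg_trace (x + y) = reg_trace x + reg_trace y" "reg_trace 0 = 0"
  "reg_trace (x - y) = reg_trace x - reg_trace y"
  "reg_trace (alg_scale A c x) = c * reg_trace x"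
  by (simp_all add: reg_trace_def mult_add_left mult_diff mult_scale_left sum.distrib
      sum_subtractf sum_distrib_left)

lemma reg_trace_sum: "reg_trace (\<Sum>i\<in>K. f i) = (\<Sum>i\<in>K. reg_trace (f i))"
  by (induction K rule: infinite_finite_induct) simp_all

lemma coord_mult_expansion: "coord (x \<star> y) p = (\<Sum>a\<in>D. coord y a * coord (x \<star> a) p)"
  by (rule linear_expansion[of "\<lambda>y. coord (x \<star> y) p" "(*)"])
    (simp_all add: mult_add_right mult_scale_right)

lemma reg_trace_commute: "reg_trace (x \<star> y) = reg_trace (y \<star> x)"
proof -
  have "reg_trace (x \<star> y) = (\<Sum>k\<in>D. \<Sum>a\<in>D. coord (y \<star> k) a * coord (x \<star> a) k)"
    unfolding reg_trace_def mult_assoc by (subst coord_mult_expansion) simp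
  also have "\<dots> = (\<Sum>a\<in>D. \<Sum>k\<in>D. coord (x \<star> a) k * coord (y \<star> k) a)"
    by (subst sum.swap) (simp add: mult.commute)
  also have "\<dots> = reg_trace (y \<star> x)"
    unfolding reg_trace_def mult_assoc by (subst (2) coord_mult_expansion) simp
  finally show ?thesis .
qed

definition nondegenerate_trace_form :: bool where
  "nondegenerate_trace_form \<longleftrightarrow> (\<forall>x. (\<forall>y. reg_trace (x \<star> y) = 0) \<longrightarrow> x = 0)"

text \<open>The trace of an idempotent operator is its rank: factor the operator through its image \<open>V\<close>
  and exchange the two factors under the trace, which leaves the trace of the identity of \<open>V\<close>. In
  characteristic 0 the rank can vanish in the ground field only if it vanishes as an integer.\<close>

lemma idempotent_reg_trace_0:
  assumes "e \<star> e = e" and "reg_trace e = 0"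
  shows "e = 0"
proof -
  define V where "V = range (\<lambda>x. e \<star> x)"
  obtain B where B: "B \<subseteq> V" "independent B" "V \<subseteq> span B"
    using maximal_independent_subset by blast
  have finB: "finite B"
    using B(2) by (rule finiteI_independent)
  have eV: "e \<star> v = v" if "v \<in> V" for v
    using that assms(1) by (auto simp: V_def mult_assoc[symmetric])
  have expand: "(\<Sum>b\<in>B. alg_scale A (representation B (e \<star> x) b) b) = e \<star> x" for x
    using B by (intro sum_representation_eq finB) (auto simp: V_def)
  define r where "r x b = representation B (e \<star> x) b" for x b
  have spanB: "e \<star> x \<in> span B" for x
    using B by (auto simp: V_def)
  have r_expand: "r v b = (\<Sum>k\<in>D. coord v k * r k b)" for v b
    by (rule linear_expansion[of "\<lambda>v. r v b" "(*)"])
      (simp_all add: r_def mult_add_right mult_scale_right representation_add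
        representation_scale B(2) spanB)
  \<comment> \<open>The matrix \<open>r\<close> of the corestriction to \<open>V\<close>, in the bases \<open>D\<close> and \<open>B\<close>,
    is moved past the inclusion of \<open>V\<close>.\<close>
  have "reg_trace e = (\<Sum>k\<in>D. coord (\<Sum>b\<in>B. alg_scale A (r k b) b) k)"
    by (simp add: reg_trace_def r_def expand del: coord_sum)
  also have "\<dots> = (\<Sum>b\<in>B. \<Sum>k\<in>D. coord b k * r k b)"
    by (subst sum.swap) (simp add: mult.commute)
  also have "\<dots> = (\<Sum>b\<in>B. r b b)"
    by (simp add: r_expand[symmetric])
  also have "\<dots> = (\<Sum>b\<in>B. 1)"
    using B eV by (intro sum.cong) (auto simp: r_def representation_basis)
  finally have "of_nat (card B) = (0::complex)" using assms(2) by simp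
  then have "B = {}" using finB by simp
  then show "e = 0" using expand[of "alg_one A"] by (simp add: mult_one_right)
qed

text \<open>The radical \<open>R\<close> of the trace form is an ideal. If \<open>R\<close> has a complement \<open>L\<close> among the left
  ideals, decompose the unit as \<open>e + e'\<close> with \<open>e\<close> in \<open>R\<close> and \<open>e'\<close> in \<open>L\<close>. For \<open>x\<close> in \<open>R\<close> the
  product \<open>x e'\<close> lies in both summands, so it is zero and \<open>x = x e\<close>. Hence \<open>e\<close> is an idempotent
  of trace 0, which makes \<open>e\<close> and with it \<open>R\<close> vanish.\<close>

lemma semisimple_imp_nondegenerate_trace_form:
  assumes "semisimple_algebra A"
  shows nondegenerate_trace_form
proof -
  define R where "R = {x. \<forall>y. reg_trace (x \<star> y) = 0}"
  have "left_ideal A R"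
    unfolding left_ideal_def
  proof (intro conjI ballI allI)
    fix a x assume "x \<in> R"
    then have "reg_trace (x \<star> (y \<star> a)) = 0" for y by (simp add: R_def)
    then have "reg_trace ((a \<star> x) \<star> y) = 0" for y
      by (metis mult_assoc reg_trace_commute)
    then show "a \<star> x \<in> R" by (simp add: R_def)
  qed (auto simp: R_def mult_add_left)
  from assms[unfolded semisimple_algebra_def, rule_format, OF this]
  obtain L where L: "left_ideal A L" "R \<inter> L = {0}" "{x + y |x y. x \<in> R \<and> y \<in> L} = UNIV"
    by (elim exE conjE) (rule that)
  have "alg_one A \<in> {x + y |x y. x \<in> R \<and> y \<in> L}"
    unfolding L(3) by simp
  then obtain e e' where e: "alg_one A = e + e'" "e \<in> R" "e' \<in> L"
    by auto
  have R_mult: "x \<star> y \<in> R" if "x \<in> R" for x y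
    using that by (simp add: R_def mult_assoc)
  have split: "x = x \<star> e + x \<star> e'" for x
    by (metis e(1) mult_add_right mult_one_right)
  have e'_zero: "x \<star> e' = 0" if "x \<in> R" for x
  proof -
    have "x \<star> e' \<in> L" using L(1) e(3) by (simp add: left_ideal_def)
    then show ?thesis using R_mult[OF that] L(2) by blast
  qed
  have "e \<star> e = e" using split[of e] e'_zero[OF e(2)] by simp
  moreover have "reg_trace (e \<star> alg_one A) = 0"
    using e(2) unfolding R_def by blast
  ultimately have "e = 0"
    unfolding mult_one_right by (rule idempotent_reg_trace_0)
  have "x = 0" if "x \<in> R" for x
    using split[of x] e'_zero[OF that] \<open>e = 0\<close> by simp
  then show ?thesis by (auto simp: nondegenerate_trace_form_def R_def)
qed

text \<open>From here on, \<open>dual j\<close> for \<open>j\<close> in \<open>D\<close> is the basis dual to \<open>D\<close> under the trace form.\<close>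

context
  fixes dual :: "'v \<Rightarrow> 'v"
  assumes dual: "\<And>i j. i \<in> D \<Longrightarrow> j \<in> D \<Longrightarrow> reg_trace (i \<star> dual j) = (if i = j then 1 else 0)"
begin

lemma coord_eq_trace_dual: "j \<in> D \<Longrightarrow> coord x j = reg_trace (x \<star> dual j)"
proof -
  assume j: "j \<in> D"
  have "reg_trace (x \<star> dual j) = (\<Sum>i\<in>D. coord x i * reg_trace (i \<star> dual j))"
    by (rule linear_expansion[of "\<lambda>x. reg_trace (x \<star> dual j)" "(*)"])
      (simp_all add: mult_add_left mult_scale_left)
  then show ?thesis using j by (simp add: dual finite_Basis if_distrib cong: if_cong)
qed

lemma trace_form_eqI: "(\<And>y. reg_trace (x \<star> y) = reg_trace (x' \<star> y)) \<Longrightarrow> x = x'"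
  by (rule coord_eqI) (simp add: coord_eq_trace_dual)

lemma dual_expansion: "x = (\<Sum>j\<in>D. alg_scale A (reg_trace (x \<star> j)) (dual j))"
proof (rule trace_form_eqI)
  fix y
  have "reg_trace (x \<star> y) = reg_trace (y \<star> x)" by (rule reg_trace_commute)
  also have "\<dots> = (\<Sum>j\<in>D. coord y j * reg_trace (j \<star> x))"
    by (rule linear_expansion[of "\<lambda>y. reg_trace (y \<star> x)" "(*)"])
      (simp_all add: mult_add_left mult_scale_left)
  also have "\<dots> = (\<Sum>j\<in>D. reg_trace (x \<star> j) * reg_trace (dual j \<star> y))"
    by (intro sum.cong) (simp_all add: coord_eq_trace_dual reg_trace_commute mult.commute)
  also have "\<dots> = reg_trace ((\<Sum>j\<in>D. alg_scale A (reg_trace (x \<star> j)) (dual j)) \<star> y)"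
    by (simp add: mult_sum reg_trace_sum mult_scale_left)
  finally show "reg_trace (x \<star> y) = \<dots>" .
qed

text \<open>The Casimir element \<open>\<Sum>\<^sub>i d\<^sub>i \<otimes> d\<^sup>i\<close> commutes with \<open>a\<close>: in the bases \<open>D\<close> and its dual, left
  multiplication on the first factor and right multiplication on the second have transposed matrices,
  by invariance of the trace under cyclic permutations. A bilinear map \<open>\<beta>\<close> stands in for the tensor
  product.\<close>

lemma casimir_central:
  fixes \<beta> :: "'v \<Rightarrow> 'v \<Rightarrow> 'v"
  assumes "\<And>x x' y. \<beta> (x + x') y = \<beta> x y + \<beta> x' y" "\<And>x y y'. \<beta> x (y + y') = \<beta> x y + \<beta> x y'"
    and "\<And>c x y. \<beta> (alg_scale A c x) y = alg_scale A c (\<beta> x y)"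
    and "\<And>c x y. \<beta> x (alg_scale A c y) = alg_scale A c (\<beta> x y)"
  shows "(\<Sum>i\<in>D. \<beta> (a \<star> i) (dual i)) = (\<Sum>i\<in>D. \<beta> i (dual i \<star> a))"
proof -
  have zero: "\<beta> x 0 = 0" for x using assms(2)[of x 0 0] by simp
  have \<beta>_sum: "\<beta> x (\<Sum>j\<in>K. f j) = (\<Sum>j\<in>K. \<beta> x (f j))" for x K f
    by (induction K rule: infinite_finite_induct) (simp_all add: zero assms(2))
  have "(\<Sum>i\<in>D. \<beta> (a \<star> i) (dual i))
      = (\<Sum>i\<in>D. \<Sum>j\<in>D. alg_scale A (coord (a \<star> i) j) (\<beta> j (dual i)))"
    by (intro sum.cong refl linear_expansion[of "\<lambda>x. \<beta> x (dual _)" "alg_scale A"])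
      (simp_all add: assms)
  also have "\<dots> = (\<Sum>j\<in>D. \<Sum>i\<in>D. alg_scale A (reg_trace (dual j \<star> a \<star> i)) (\<beta> j (dual i)))"
    by (subst sum.swap, intro sum.cong refl)
      (simp add: coord_eq_trace_dual mult_assoc reg_trace_commute[of "dual _"])
  also have "\<dots> = (\<Sum>j\<in>D. \<beta> j (dual j \<star> a))"
  proof (intro sum.cong refl)
    fix j
    show "(\<Sum>i\<in>D. alg_scale A (reg_trace (dual j \<star> a \<star> i)) (\<beta> j (dual i))) = \<beta> j (dual j \<star> a)"
      by (subst (2) dual_expansion[of "dual j \<star> a"]) (simp only: \<beta>_sum assms(4))
  qed
  finally show ?thesis .
qed

text \<open>Here it matters that the form is the trace form of the regular representation: pairing
  \<open>\<Sum>\<^sub>i d\<^sub>i d\<^sup>i\<close> with \<open>y\<close> gives the trace of left multiplication by \<open>y\<close>, which is the pairing of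
  the unit with \<open>y\<close>.\<close>

lemma casimir_unit: "(\<Sum>i\<in>D. i \<star> dual i) = alg_one A"
proof (rule trace_form_eqI)
  fix y
  have "reg_trace ((\<Sum>i\<in>D. i \<star> dual i) \<star> y) = (\<Sum>i\<in>D. reg_trace (y \<star> i \<star> dual i))"
    by (simp add: mult_sum reg_trace_sum reg_trace_commute[of y] mult_assoc)
  also have "\<dots> = reg_trace y"
    by (simp add: coord_eq_trace_dual[symmetric] reg_trace_def[of y])
  finally show "reg_trace ((\<Sum>i\<in>D. i \<star> dual i) \<star> y) = reg_trace (alg_one A \<star> y)"
    by (simp add: mult_one_left)
qed

text \<open>The contraction of a cochain with the Casimir element; it is the cochain of which a 2-cocycle is
  the coboundary.\<close>

definition splitting :: "('v \<Rightarrow> 'v \<Rightarrow> 'v) \<Rightarrow> 'v \<Rightarrow> 'v" where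
  "splitting m x = (\<Sum>i\<in>D. i \<star> m (dual i) x)"

text \<open>Vanishing of the second Hochschild cohomology, with an explicit primitive: put the \<open>dual i\<close>
  into the first argument of the cocycle identity, multiply by \<open>i\<close> from the left and sum. The
  two properties of the Casimir element turn the four sums into the four terms of the claim.\<close>

lemma cocycle_splits:
  assumes bilinear: "\<And>x x' y. m (x + x') y = m x y + m x' y" "\<And>x y y'. m x (y + y') = m x y + m x y'"
     "\<And>c x y. m (alg_scale A c x) y = alg_scale A c (m x y)"
     "\<And>c x y. m x (alg_scale A c y) = alg_scale A c (m x y)"
    and cocycle: "\<And>x y z. m (x \<star> y) z + m x y \<star> z = m x (y \<star> z) + x \<star> m y z"
  shows "m y z = splitting m y \<star> z + y \<star> splitting m z - splitting m (y \<star> z)"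
proof -
  have "m y z = (\<Sum>i\<in>D. i \<star> (dual i \<star> m y z))"
    by (simp add: mult_assoc[symmetric] mult_sum(1)[symmetric] casimir_unit mult_one_left)
  also have "\<dots> = (\<Sum>i\<in>D. i \<star> m (dual i \<star> y) z + (i \<star> m (dual i) y) \<star> z - i \<star> m (dual i) (y \<star> z))"
  proof (intro sum.cong refl)
    fix i
    have "dual i \<star> m y z = m (dual i \<star> y) z + m (dual i) y \<star> z - m (dual i) (y \<star> z)"
      using cocycle[of "dual i" y z] by (simp add: algebra_simps)
    then show "i \<star> (dual i \<star> m y z)
        = i \<star> m (dual i \<star> y) z + (i \<star> m (dual i) y) \<star> z - i \<star> m (dual i) (y \<star> z)"
      by (simp add: mult_diff mult_add_right mult_assoc)
  qed
  also have "\<dots> = (\<Sum>i\<in>D. i \<star> m (dual i \<star> y) z) + splitting m y \<star> z - splitting m (y \<star> z)"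
    by (simp add: sum.distrib sum_subtractf splitting_def mult_sum)
  also have "(\<Sum>i\<in>D. i \<star> m (dual i \<star> y) z) = (\<Sum>i\<in>D. (y \<star> i) \<star> m (dual i) z)"
    by (rule casimir_central[symmetric, of "\<lambda>x x'. x \<star> m x' z"])
      (simp_all add: bilinear mult_add_left mult_add_right mult_scale_left mult_scale_right)
  also have "\<dots> = y \<star> splitting m z"
    by (simp add: splitting_def mult_sum mult_assoc)
  finally show ?thesis by (simp add: algebra_simps)
qed

end

end

section \<open>Linear differential equations with holomorphic coefficients\<close>

lemma eval_fps_sum_mult:
  fixes f h :: "'i \<Rightarrow> complex fps"
  assumes "\<And>a. a \<in> K \<Longrightarrow> ereal (norm z) < fps_conv_radius (f a)"
    and "\<And>a. a \<in> K \<Longrightarrow> ereal (norm z) < fps_conv_radius (h a)"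
  shows "eval_fps (\<Sum>a\<in>K. f a * h a) z = (\<Sum>a\<in>K. eval_fps (f a) z * eval_fps (h a) z)"
proof -
  have "(\<lambda>n. fps_nth (f a * h a) n * z ^ n) sums (eval_fps (f a) z * eval_fps (h a) z)" if "a \<in> K" for a
  proof -
    have "ereal (norm z) < fps_conv_radius (f a * h a)"
      by (rule less_le_trans[OF _ fps_conv_radius_mult]) (use assms that in simp)
    then show ?thesis using assms that sums_eval_fps by (simp add: eval_fps_mult[symmetric])
  qed
  then have "(\<lambda>n. \<Sum>a\<in>K. fps_nth (f a * h a) n * z ^ n) sums
      (\<Sum>a\<in>K. eval_fps (f a) z * eval_fps (h a) z)"
    by (rule sums_sum)
  then have "(\<lambda>n. fps_nth (\<Sum>a\<in>K. f a * h a) n * z ^ n) sums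
      (\<Sum>a\<in>K. eval_fps (f a) z * eval_fps (h a) z)"
    by (simp only: fps_sum_nth sum_distrib_right)
  then show ?thesis
    unfolding eval_fps_def by (rule sums_unique[symmetric])
qed

text \<open>The Taylor coefficients at the initial point of the solution of \<open>y' = F y\<close> with initial value
  \<open>y0\<close>, obtained by comparing coefficients in the equation.\<close>

fun ode_coeff :: "'i set \<Rightarrow> ('i \<Rightarrow> 'i \<Rightarrow> complex fps) \<Rightarrow> ('i \<Rightarrow> complex) \<Rightarrow> nat \<Rightarrow> 'i \<Rightarrow> complex" where
  "ode_coeff I F y0 0 p = y0 p"
| "ode_coeff I F y0 (Suc n) p =
     (\<Sum>q\<in>I. \<Sum>k=0..n. fps_nth (F p q) k * ode_coeff I F y0 (n - k) q) / of_nat (Suc n)"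

lemma fps_coeff_bound:
  fixes f :: "complex fps"
  assumes "fps_conv_radius f > ereal r" and "r > 0"
  obtains M where "M \<ge> 0" and "\<And>k. norm (fps_nth f k) \<le> M * (1 / r) ^ k"
proof -
  have "summable (\<lambda>k. fps_nth f k * of_real r ^ k)"
    using assms by (intro summable_fps) auto
  then have "bounded (range (\<lambda>k. fps_nth f k * of_real r ^ k))"
    using summable_imp_bounded by blast
  then obtain M where M: "\<And>k. norm (fps_nth f k * of_real r ^ k) \<le> M"
    by (auto simp: bounded_iff)
  have "norm (fps_nth f k) \<le> M * (1 / r) ^ k" for k
    using M[of k] assms(2) by (simp add: norm_mult norm_power field_simps)
  moreover have "M \<ge> 0" using M[of 0] norm_ge_zero order_trans by blast
  ultimately show ?thesis using that by blast
qed

text \<open>Convergence of the formal solution by the method of majorants. In the recursion the number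
  \<open>Suc n\<close> of indices \<open>k\<close> cancels against the denominator, so each step costs at most the factor
  \<open>card I * M\<close>.\<close>

lemma ode_coeff_bound:
  assumes "finite I" and M: "M \<ge> 0" and "K \<ge> 0" and "C \<ge> 0"
    and F: "\<And>p q k. p \<in> I \<Longrightarrow> q \<in> I \<Longrightarrow> norm (fps_nth (F p q) k) \<le> M * K ^ k"
    and y0: "\<And>p. p \<in> I \<Longrightarrow> norm (y0 p) \<le> C"
    and L: "L \<ge> K" "L \<ge> of_nat (card I) * M"
  shows "p \<in> I \<Longrightarrow> norm (ode_coeff I F y0 n p) \<le> C * L ^ n"
proof (induction n arbitrary: p rule: less_induct)
  case (less n)
  have "L \<ge> 0" using L(1) assms(3) by simp
  show ?case
  proof (cases n)
    case 0
    then show ?thesis using y0 less.prems by simp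
  next
    case (Suc m)
    have "norm (\<Sum>q\<in>I. \<Sum>k=0..m. fps_nth (F p q) k * ode_coeff I F y0 (m - k) q)
        \<le> (\<Sum>q\<in>I. \<Sum>k=0..m. M * C * L ^ m)"
    proof (intro sum_norm_le)
      fix q k assume q: "q \<in> I" and k: "k \<in> {0..m}"
      have "norm (fps_nth (F p q) k * ode_coeff I F y0 (m - k) q) \<le> (M * L ^ k) * (C * L ^ (m - k))"
        unfolding norm_mult
      proof (intro mult_mono)
        show "norm (fps_nth (F p q) k) \<le> M * L ^ k"
          by (rule order_trans[OF F[OF less.prems q]])
            (intro mult_left_mono power_mono L(1) assms M)
        show "norm (ode_coeff I F y0 (m - k) q) \<le> C * L ^ (m - k)"
          using Suc q by (intro less.IH) auto
      qed (use M \<open>L \<ge> 0\<close> in auto)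
      also have "\<dots> = M * C * L ^ m"
        using k by (simp add: power_add[symmetric])
      finally show "norm (fps_nth (F p q) k * ode_coeff I F y0 (m - k) q) \<le> M * C * L ^ m" .
    qed
    also have "\<dots> = real (Suc m) * ((of_nat (card I) * M) * (C * L ^ m))"
      by simp
    also have "\<dots> \<le> real (Suc m) * (L * (C * L ^ m))"
      using L assms(4) \<open>L \<ge> 0\<close> by (intro mult_left_mono mult_right_mono) auto
    finally show ?thesis
      using Suc by (simp add: norm_divide divide_simps mult_ac del: of_nat_Suc)
  qed
qed

text \<open>The radius does not depend on the initial value, because the growth rate \<open>L\<close> of the coefficients
  depends on \<open>F\<close> alone. This makes it possible to solve for all vectors
  of a basis on one disc.\<close>

lemma linear_ode_solvable:
  fixes F :: "'i \<Rightarrow> 'i \<Rightarrow> complex \<Rightarrow> complex"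
  assumes I: "finite I" and U: "open U" "s0 \<in> U"
    and F: "\<And>p q. p \<in> I \<Longrightarrow> q \<in> I \<Longrightarrow> F p q holomorphic_on U"
  obtains r where "r > 0" and "ball s0 r \<subseteq> U"
    and "\<And>y0. \<exists>y. \<forall>p\<in>I. y p s0 = y0 p \<and>
           (\<forall>s\<in>ball s0 r. (y p has_field_derivative (\<Sum>q\<in>I. F p q s * y q s)) (at s))"
proof -
  obtain R where R: "R > 0" "ball s0 R \<subseteq> U"
    using U openE by blast
  define G where "G p q = fps_expansion (F p q) s0" for p q
  have holo: "F p q holomorphic_on eball s0 (ereal R)" if "p \<in> I" "q \<in> I" for p q
    using holomorphic_on_subset[OF F[OF that]] R by simp
  have G_radius: "fps_conv_radius (G p q) \<ge> ereal R" if "p \<in> I" "q \<in> I" for p q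
    unfolding G_def by (rule conv_radius_fps_expansion[OF holo[OF that]])
  have G_eval: "eval_fps (G p q) (s - s0) = F p q s" if "p \<in> I" "q \<in> I" "s \<in> ball s0 R" for p q s
    unfolding G_def using eval_fps_expansion[OF holo[OF that(1,2)]] that by simp
  \<comment> \<open>Cauchy estimates hold on every circle strictly inside the disc of radius \<open>R\<close>.\<close>
  define K where "K = 1 / (R / 2)"
  have "\<exists>M\<ge>0. \<forall>k. norm (fps_nth (G p q) k) \<le> M * K ^ k" if "p \<in> I" "q \<in> I" for p q
  proof -
    have "ereal (R / 2) < fps_conv_radius (G p q)"
      by (rule less_le_trans[OF _ G_radius[OF that]]) (use R in simp)
    from fps_coeff_bound[OF this] R show ?thesis unfolding K_def by (metis half_gt_zero)
  qed
  then obtain m where m: "\<And>p q. p \<in> I \<Longrightarrow> q \<in> I \<Longrightarrow> m p q \<ge> 0"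
      "\<And>p q k. p \<in> I \<Longrightarrow> q \<in> I \<Longrightarrow> norm (fps_nth (G p q) k) \<le> m p q * K ^ k"
    by metis
  define M where "M = (\<Sum>p\<in>I. \<Sum>q\<in>I. m p q)"
  have M: "m p q \<le> M" if "p \<in> I" "q \<in> I" for p q
  proof -
    have "m p q \<le> (\<Sum>q\<in>I. m p q)" using that I m by (intro member_le_sum) auto
    also have "\<dots> \<le> M" unfolding M_def
      using that I m by (intro member_le_sum[of p I "\<lambda>p. \<Sum>q\<in>I. m p q"]) (auto intro: sum_nonneg)
    finally show ?thesis .
  qed
  have "M \<ge> 0" unfolding M_def using m by (auto intro!: sum_nonneg)
  have "K > 0" using R by (simp add: K_def)
  define L where "L = K + of_nat (card I) * M"
  have "L > 0" using \<open>K > 0\<close> \<open>M \<ge> 0\<close> by (simp add: L_def add_pos_nonneg)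
  define r where "r = min R (1 / L)"
  have r: "r > 0" "r \<le> R" "r \<le> 1 / L" using R \<open>L > 0\<close> by (auto simp: r_def)
  have "\<exists>y. \<forall>p\<in>I. y p s0 = y0 p \<and>
           (\<forall>s\<in>ball s0 r. (y p has_field_derivative (\<Sum>q\<in>I. F p q s * y q s)) (at s))" for y0
  proof -
    define Y where "Y p = Abs_fps (\<lambda>n. ode_coeff I G y0 n p)" for p
    define C where "C = (\<Sum>p\<in>I. norm (y0 p))"
    have C: "norm (y0 p) \<le> C" if "p \<in> I" for p
      unfolding C_def using that I by (intro member_le_sum) auto
    have "C \<ge> 0" unfolding C_def by (auto intro: sum_nonneg)
    have bound: "norm (fps_nth (Y p) n) \<le> C * L ^ n" if "p \<in> I" for p n
      unfolding Y_def fps_nth_Abs_fps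
    proof (rule ode_coeff_bound[where M = M and K = K])
      fix p q k assume pq: "p \<in> I" "q \<in> I"
      have "norm (fps_nth (G p q) k) \<le> m p q * K ^ k" by (rule m(2)[OF pq])
      also have "\<dots> \<le> M * K ^ k" using M[OF pq] \<open>K > 0\<close> by (intro mult_right_mono) auto
      finally show "norm (fps_nth (G p q) k) \<le> M * K ^ k" .
    qed (use that I \<open>M \<ge> 0\<close> \<open>K > 0\<close> \<open>C \<ge> 0\<close> C in \<open>auto simp: L_def\<close>)
    have radius: "fps_conv_radius (Y p) \<ge> ereal (1 / L)" if "p \<in> I" for p
      unfolding fps_conv_radius_def
    proof (rule conv_radius_geI_ex)
      fix \<rho> :: real assume \<rho>: "\<rho> > 0" "ereal \<rho> < ereal (1 / L)"
      have "summable (\<lambda>n. C * (L * \<rho>) ^ n)"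
        using \<rho> \<open>L > 0\<close> by (intro summable_mult summable_geometric) (simp add: field_simps)
      then have "summable (\<lambda>n. fps_nth (Y p) n * of_real \<rho> ^ n)"
      proof (rule summable_comparison_test')
        fix n
        show "norm (fps_nth (Y p) n * of_real \<rho> ^ n) \<le> C * (L * \<rho>) ^ n"
          using mult_right_mono[OF bound[OF that, of n], of "\<rho> ^ n"] \<rho>
          by (simp add: norm_mult norm_power power_mult_distrib mult_ac)
      qed
      then show "\<exists>z. norm z = \<rho> \<and> summable (\<lambda>n. fps_nth (Y p) n * z ^ n)"
        using \<rho> by (intro exI[of _ "of_real \<rho>"]) simp
    qed
    have deriv: "fps_deriv (Y p) = (\<Sum>q\<in>I. G p q * Y q)" for p
      by (rule fps_ext) (simp add: Y_def fps_sum_nth fps_mult_nth del: of_nat_Suc)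
    have solves: "((\<lambda>s. eval_fps (Y p) (s - s0)) has_field_derivative
             (\<Sum>q\<in>I. F p q s * eval_fps (Y q) (s - s0))) (at s)"
      if p: "p \<in> I" and s: "s \<in> ball s0 r" for p s
    proof -
      have s': "norm (s - s0) < r" using s by (simp add: dist_norm norm_minus_commute)
      have in_Y: "ereal (norm (s - s0)) < fps_conv_radius (Y q)" if "q \<in> I" for q
        by (rule less_le_trans[OF _ radius[OF that]]) (use s' r in simp)
      have in_G: "ereal (norm (s - s0)) < fps_conv_radius (G p q)" if "q \<in> I" for q
        by (rule less_le_trans[OF _ G_radius[OF p that]]) (use s' r in simp)
      have "eval_fps (fps_deriv (Y p)) (s - s0) = (\<Sum>q\<in>I. F p q s * eval_fps (Y q) (s - s0))"
        unfolding deriv using p s r in_G in_Y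
        by (subst eval_fps_sum_mult) (auto simp: G_eval)
      then have deriv_Y: "(eval_fps (Y p) has_field_derivative
          (\<Sum>q\<in>I. F p q s * eval_fps (Y q) (s - s0))) (at (s - s0))"
        using has_field_derivative_eval_fps[OF in_Y[OF p]] by metis
      have "((\<lambda>s. s - s0) has_field_derivative 1) (at s)"
        by (auto intro!: derivative_eq_intros)
      from DERIV_chain2[OF deriv_Y this] show ?thesis by simp
    qed
    have initial: "eval_fps (Y p) (s0 - s0) = y0 p" for p
      by (simp add: eval_fps_at_0 Y_def)
    show ?thesis
      by (rule exI[of _ "\<lambda>p s. eval_fps (Y p) (s - s0)"]) (intro ballI conjI initial solves)
  qed
  moreover have "ball s0 r \<subseteq> U"
    using subset_ball[OF r(2), of s0] R(2) by (rule order_trans)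
  ultimately show ?thesis
    using r(1) by (intro that)
qed

section \<open>Determinants and adjugates of holomorphic matrices\<close>

lemma holomorphic_on_det:
  assumes "\<And>i j. i < n \<Longrightarrow> j < n \<Longrightarrow> (\<lambda>s. B s $$ (i, j)) holomorphic_on U"
    and "\<And>s. B s \<in> carrier_mat n n"
  shows "(\<lambda>s. det (B s)) holomorphic_on U"
proof -
  have "(\<lambda>s. det (B s)) =
      (\<lambda>s. \<Sum>p | p permutes {0..<n}. signof p * (\<Prod>i = 0..<n. B s $$ (i, p i)))"
    by (simp add: Determinant.det_def'[OF assms(2)])
  moreover have "p i < n" if "p permutes {0..<n}" "i < n" for p i
    using permutes_in_image[OF that(1), of i] that(2) by simp
  then have "(\<lambda>s. \<Sum>p | p permutes {0..<n}. signof p * (\<Prod>i = 0..<n. B s $$ (i, p i)))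
      holomorphic_on U"
    by (intro holomorphic_intros assms(1)) auto
  ultimately show ?thesis by simp
qed

text \<open>For a matrix \<open>T\<close> indexed by an arbitrary finite set, \<open>\<Delta>\<close> is its determinant and \<open>S\<close> its
  adjugate, both polynomial in the entries.\<close>

lemma holomorphic_adjugate:
  fixes T :: "'i \<Rightarrow> 'i \<Rightarrow> complex \<Rightarrow> complex"
  assumes I: "finite I"
    and T: "\<And>p q. p \<in> I \<Longrightarrow> q \<in> I \<Longrightarrow> T p q holomorphic_on U"
  obtains \<Delta> S where "\<Delta> holomorphic_on U"
    and "\<And>p q. p \<in> I \<Longrightarrow> q \<in> I \<Longrightarrow> S p q holomorphic_on U"
    and "\<And>p q s. p \<in> I \<Longrightarrow> q \<in> I \<Longrightarrow> (\<Sum>a\<in>I. T p a s * S a q s) = (if p = q then \<Delta> s else 0)"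
    and "\<And>s. \<Delta> s = 0 \<Longrightarrow> \<exists>v. (\<exists>p\<in>I. v p \<noteq> 0) \<and> (\<forall>p\<in>I. (\<Sum>q\<in>I. T p q s * v q) = 0)"
proof -
  define n where "n = card I"
  obtain e where e: "bij_betw e {0..<n} I"
    using ex_bij_betw_nat_finite[OF I] n_def by blast
  define e' where "e' = the_inv_into {0..<n} e"
  have e'e[simp]: "e' (e i) = i" if "i < n" for i
    using that e unfolding e'_def by (simp add: bij_betw_def the_inv_into_f_f)
  have e'[simp]: "e' p < n" "e (e' p) = p" if "p \<in> I" for p
  proof -
    have "p \<in> e ` {0..<n}" using that e by (simp add: bij_betw_def)
    then show "e' p < n" "e (e' p) = p" by auto
  qed
  have e_in[simp]: "e i \<in> I" if "i < n" for i using e that by (auto simp: bij_betw_def)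
  have e'_eq: "e' p = e' q \<longleftrightarrow> p = q" if "p \<in> I" "q \<in> I" for p q
    using e'(2) that by metis
  have sum_e: "(\<Sum>a\<in>I. f a) = (\<Sum>i=0..<n. f (e i))" for f :: "'i \<Rightarrow> complex"
    using sum.reindex_bij_betw[OF e, of f] by simp
  \<comment> \<open>The index set is enumerated so that the determinant of a matrix indexed by numbers applies.\<close>
  define B where "B s = mat n n (\<lambda>(i, j). T (e i) (e j) s)" for s
  have B[simp]: "B s \<in> carrier_mat n n" for s by (simp add: B_def)
  define \<Delta> where "\<Delta> s = det (B s)" for s
  define S where "S p q s = adj_mat (B s) $$ (e' p, e' q)" for p q s
  show ?thesis
  proof (rule that[of \<Delta> S])
    show "\<Delta> holomorphic_on U"
      unfolding \<Delta>_def by (rule holomorphic_on_det[where n = n]) (auto simp: B_def intro!: T)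
  next
    fix p q assume pq: "p \<in> I" "q \<in> I"
    have "(\<lambda>s. det (mat_delete (B s) (e' q) (e' p))) holomorphic_on U"
    proof (rule holomorphic_on_det[where n = "n - 1"])
      show "(\<lambda>s. mat_delete (B s) (e' q) (e' p) $$ (i, j)) holomorphic_on U"
        if "i < n - 1" "j < n - 1" for i j
        using that by (auto simp: B_def mat_delete_def intro!: T)
      show "mat_delete (B s) (e' q) (e' p) \<in> carrier_mat (n - 1) (n - 1)" for s
        by (simp add: B_def mat_delete_def)
    qed
    moreover have "S p q = (\<lambda>s. (-1) ^ (e' q + e' p) * det (mat_delete (B s) (e' q) (e' p)))"
      using pq by (simp add: fun_eq_iff S_def adj_mat_def cofactor_def B_def)
    ultimately show "S p q holomorphic_on U"
      by (simp add: holomorphic_on_mult)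
  next
    fix p q s assume pq: "p \<in> I" "q \<in> I"
    have "(B s * adj_mat (B s)) $$ (e' p, e' q) = (\<Delta> s \<cdot>\<^sub>m 1\<^sub>m n) $$ (e' p, e' q)"
      unfolding \<Delta>_def using adj_mat(2)[OF B] by simp
    moreover have "(B s * adj_mat (B s)) $$ (e' p, e' q) = (\<Sum>i=0..<n. T p (e i) s * S (e i) q s)"
      using pq adj_mat(1)[OF B, of s] by (simp add: S_def scalar_prod_def B_def)
    ultimately show "(\<Sum>a\<in>I. T p a s * S a q s) = (if p = q then \<Delta> s else 0)"
      using pq by (simp add: sum_e e'_eq)
  next
    fix s assume "\<Delta> s = 0"
    then obtain v where v: "v \<in> carrier_vec n" "v \<noteq> 0\<^sub>v n" "B s *\<^sub>v v = 0\<^sub>v n"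
      unfolding \<Delta>_def using det_0_iff_vec_prod_zero_field[OF B] by blast
    have "\<exists>i<n. v $ i \<noteq> 0" using v(1,2) by (auto simp: vec_eq_iff)
    moreover have "(\<Sum>q\<in>I. T p q s * v $ e' q) = 0" if "p \<in> I" for p
    proof -
      have "(B s *\<^sub>v v) $ e' p = 0" using v(3) that by simp
      then show ?thesis using that v(1) by (simp add: B_def scalar_prod_def sum_e)
    qed
    ultimately show "\<exists>v. (\<exists>p\<in>I. v p \<noteq> 0) \<and> (\<forall>p\<in>I. (\<Sum>q\<in>I. T p q s * v q) = 0)"
      by (intro exI[of _ "\<lambda>p. v $ e' p"]) (metis e_in e'e)
  qed
qed

section \<open>Isomorphisms of algebras\<close>

text \<open>A surjective multiplicative map preserves the unit automatically, because its value at the unit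
  acts as the identity on the image.\<close>

lemma alg_isomorphicI:
  fixes A :: "'a::ab_group_add calg" and B :: "'b::ab_group_add calg"
  assumes A: "complex_algebra A" and B: "complex_algebra B"
    and \<phi>: "Vector_Spaces.linear (alg_scale A) (alg_scale B) \<phi>" "bij \<phi>"
    and mult: "\<And>x y. \<phi> (alg_mult A x y) = alg_mult B (\<phi> x) (\<phi> y)"
  shows "alg_isomorphic A B"
proof -
  interpret A: complex_algebra A by fact
  interpret B: complex_algebra B by fact
  obtain e where e: "\<phi> e = alg_one B" using \<phi>(2) by (metis bij_pointE)
  have "\<phi> (alg_one A) = alg_mult B (\<phi> (alg_one A)) (\<phi> e)"
    by (simp add: e B.mult_one_right)
  also have "\<dots> = \<phi> (alg_mult A (alg_one A) e)"
    by (rule mult[symmetric])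
  also have "\<dots> = alg_one B"
    by (simp add: A.mult_one_left e)
  finally show ?thesis using assms unfolding alg_isomorphic_def by blast
qed

lemma alg_isomorphic_sym:
  fixes A :: "'a::ab_group_add calg" and B :: "'b::ab_group_add calg"
  assumes "alg_isomorphic A B"
  shows "alg_isomorphic B A"
proof -
  obtain \<phi> where \<phi>: "Vector_Spaces.linear (alg_scale A) (alg_scale B) \<phi>" "bij \<phi>"
      "\<And>x y. \<phi> (alg_mult A x y) = alg_mult B (\<phi> x) (\<phi> y)" "\<phi> (alg_one A) = alg_one B"
    using assms unfolding alg_isomorphic_def by blast
  interpret Vector_Spaces.linear "alg_scale A" "alg_scale B" \<phi> by fact
  define \<psi> where "\<psi> = inv_into UNIV \<phi>"
  have inv: "\<phi> (\<psi> y) = y" for y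
    using \<phi>(2) by (simp add: \<psi>_def bij_is_surj surj_f_inv_f)
  have inj: "x = y" if "\<phi> x = \<phi> y" for x y using that \<phi>(2) by (simp add: bij_def inj_eq)
  have "Vector_Spaces.linear (alg_scale B) (alg_scale A) \<psi>"
    using linear_axioms unfolding Vector_Spaces.linear_iff
    by (auto intro!: inj simp: inv add scale)
  moreover have "\<psi> (alg_mult B x y) = alg_mult A (\<psi> x) (\<psi> y)" for x y
    by (rule inj) (simp add: inv \<phi>(3))
  moreover have "\<psi> (alg_one B) = alg_one A"
    by (rule inj) (simp add: inv \<phi>(4))
  ultimately show ?thesis
    using bij_imp_bij_inv[OF \<phi>(2), folded \<psi>_def] unfolding alg_isomorphic_def by blast
qed

lemma alg_isomorphic_trans:
  fixes A :: "'a::ab_group_add calg" and B :: "'b::ab_group_add calg" and C :: "'c::ab_group_add calg"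
  assumes "alg_isomorphic A B" and "alg_isomorphic B C"
  shows "alg_isomorphic A C"
proof -
  obtain \<phi> where \<phi>: "Vector_Spaces.linear (alg_scale A) (alg_scale B) \<phi>" "bij \<phi>"
      "\<And>x y. \<phi> (alg_mult A x y) = alg_mult B (\<phi> x) (\<phi> y)" "\<phi> (alg_one A) = alg_one B"
    using assms(1) unfolding alg_isomorphic_def by blast
  obtain \<psi> where \<psi>: "Vector_Spaces.linear (alg_scale B) (alg_scale C) \<psi>" "bij \<psi>"
      "\<And>x y. \<psi> (alg_mult B x y) = alg_mult C (\<psi> x) (\<psi> y)" "\<psi> (alg_one B) = alg_one C"
    using assms(2) unfolding alg_isomorphic_def by blast
  have "Vector_Spaces.linear (alg_scale A) (alg_scale C) (\<psi> \<circ> \<phi>)"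
    using \<phi>(1) \<psi>(1) by (rule Vector_Spaces.linear_compose)
  then show ?thesis
    unfolding alg_isomorphic_def
    by (intro exI[of _ "\<psi> \<circ> \<phi>"]) (auto simp: \<phi> \<psi> bij_comp)
qed

lemma alg_isomorphic_semisimple:
  fixes A :: "'a::ab_group_add calg" and B :: "'b::ab_group_add calg"
  assumes "alg_isomorphic A B" and "semisimple_algebra B"
  shows "semisimple_algebra A"
proof -
  obtain \<phi> where \<phi>: "Vector_Spaces.linear (alg_scale A) (alg_scale B) \<phi>" "bij \<phi>"
      "\<And>x y. \<phi> (alg_mult A x y) = alg_mult B (\<phi> x) (\<phi> y)"
    using assms unfolding alg_isomorphic_def by blast
  interpret Vector_Spaces.linear "alg_scale A" "alg_scale B" \<phi> by fact
  have surj: "\<exists>x. \<phi> x = y" for y using \<phi>(2) by (metis bij_pointE)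
  have inj: "x = y" if "\<phi> x = \<phi> y" for x y using that \<phi>(2) by (simp add: bij_def inj_eq)
  show ?thesis
    unfolding semisimple_algebra_def
  proof (intro allI impI)
    fix L assume L: "left_ideal A L"
    have "left_ideal B (\<phi> ` L)"
      unfolding left_ideal_def
    proof (intro conjI ballI allI)
      show "0 \<in> \<phi> ` L" using L zero by (force simp: left_ideal_def image_iff)
      fix x assume "x \<in> \<phi> ` L"
      then obtain u where u: "x = \<phi> u" "u \<in> L" by auto
      show "x + y \<in> \<phi> ` L" if "y \<in> \<phi> ` L" for y
        using that L u by (auto simp: left_ideal_def add[symmetric])
      show "alg_mult B a x \<in> \<phi> ` L" for a
        using surj[of a] L u by (auto simp: left_ideal_def \<phi>(3)[symmetric])
    qed
    from assms(2)[unfolded semisimple_algebra_def, rule_format, OF this]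
    obtain M where M: "left_ideal B M" "\<phi> ` L \<inter> M = {0}" "{x + y |x y. x \<in> \<phi> ` L \<and> y \<in> M} = UNIV"
      by (elim exE conjE) (rule that)
    have "left_ideal A (\<phi> -` M)"
      using M(1) by (simp add: left_ideal_def add \<phi>(3) zero)
    moreover have "L \<inter> \<phi> -` M = {0}"
    proof (intro equalityI subsetI)
      fix x assume "x \<in> L \<inter> \<phi> -` M"
      then have "\<phi> x \<in> \<phi> ` L \<inter> M" by auto
      then show "x \<in> {0}" using M(2) inj[of x 0] zero by simp
    next
      fix x :: 'a assume "x \<in> {0}"
      then show "x \<in> L \<inter> \<phi> -` M" using L M(1) zero by (simp add: left_ideal_def)
    qed
    moreover have "{x + y |x y. x \<in> L \<and> y \<in> \<phi> -` M} = UNIV"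
    proof (intro equalityI subsetI UNIV_I)
      fix z
      have "\<phi> z \<in> {x + y |x y. x \<in> \<phi> ` L \<and> y \<in> M}" unfolding M(3) by simp
      then obtain u y where u: "\<phi> z = \<phi> u + y" "u \<in> L" "y \<in> M" by auto
      obtain v where "\<phi> v = y" using surj by blast
      with u inj[of z "u + v"] have "z = u + v" "\<phi> v \<in> M" by (simp_all add: add)
      with u(2) show "z \<in> {x + y |x y. x \<in> L \<and> y \<in> \<phi> -` M}" by auto
    qed
    ultimately show "\<exists>L'. left_ideal A L' \<and> L \<inter> L' = {0} \<and> {x + y |x y. x \<in> L \<and> y \<in> L'} = UNIV"
      by (intro exI[of _ "\<phi> -` M"] conjI)
  qed
qed

section \<open>Products given by structure constants\<close>

context coordinate_space
begin

definition structure_product :: "('v \<Rightarrow> 'v \<Rightarrow> 'v \<Rightarrow> complex) \<Rightarrow> 'v \<Rightarrow> 'v \<Rightarrow> 'v" where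
  "structure_product c x y = (\<Sum>i\<in>D. \<Sum>j\<in>D. \<Sum>l\<in>D. scale (coord x i * coord y j * c i j l) l)"

lemma coord_structure_product:
  assumes "l \<in> D"
  shows "coord (structure_product c x y) l = (\<Sum>i\<in>D. \<Sum>j\<in>D. coord x i * coord y j * c i j l)"
  using assms by (simp add: structure_product_def coord_basis finite_Basis if_distrib cong: if_cong)

lemma structure_product_bilinear:
  "structure_product c (x + x') y = structure_product c x y + structure_product c x' y"
  "structure_product c x (y + y') = structure_product c x y + structure_product c x y'"
  "structure_product c (scale a x) y = scale a (structure_product c x y)"
  "structure_product c x (scale a y) = scale a (structure_product c x y)"
  by (rule coord_eqI; simp add: coord_structure_product algebra_simps sum.distrib sum_distrib_left)+

lemma coord_structure_product_basis:
  assumes "l \<in> D"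
  shows "i \<in> D \<Longrightarrow> coord (structure_product c i y) l = (\<Sum>j\<in>D. coord y j * c i j l)"
    and "j \<in> D \<Longrightarrow> coord (structure_product c x j) l = (\<Sum>i\<in>D. coord x i * c i j l)"
    and "i \<in> D \<Longrightarrow> j \<in> D \<Longrightarrow> coord (structure_product c i j) l = c i j l"
proof -
  have *: "(\<Sum>j\<in>D. coord k j * f j) = f k" if "k \<in> D" for k f
    using that finite_Basis by (simp add: coord_basis if_distrib[of "\<lambda>x. x * _"] cong: if_cong)
  show 1: "i \<in> D \<Longrightarrow> coord (structure_product c i y) l = (\<Sum>j\<in>D. coord y j * c i j l)" for i y
    using assms by (simp add: coord_structure_product mult.assoc sum_distrib_left[symmetric] *)
  show "j \<in> D \<Longrightarrow> coord (structure_product c x j) l = (\<Sum>i\<in>D. coord x i * c i j l)"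
    using assms by (simp add: coord_structure_product mult.assoc sum_distrib_left[symmetric] *)
  show "i \<in> D \<Longrightarrow> j \<in> D \<Longrightarrow> coord (structure_product c i j) l = c i j l"
    by (simp add: 1 *)
qed

lemma linear_eq_on_basisI:
  fixes f h :: "'v \<Rightarrow> 'v"
  assumes "\<And>x y. f (x + y) = f x + f y" "\<And>c x. f (scale c x) = scale c (f x)"
    and "\<And>x y. h (x + y) = h x + h y" "\<And>c x. h (scale c x) = scale c (h x)"
    and "\<And>i. i \<in> D \<Longrightarrow> f i = h i"
  shows "f v = h v"
proof -
  have "f v = (\<Sum>i\<in>D. scale (coord v i) (f i))" by (rule linear_expansion) (rule assms)+
  also have "\<dots> = (\<Sum>i\<in>D. scale (coord v i) (h i))" using assms(5) by simp
  also have "\<dots> = h v" by (rule linear_expansion[symmetric]) (rule assms)+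
  finally show ?thesis .
qed

lemma trilinear_eq_on_basisI:
  fixes f h :: "'v \<Rightarrow> 'v \<Rightarrow> 'v \<Rightarrow> 'v"
  assumes "\<And>x x' y z. f (x + x') y z = f x y z + f x' y z" "\<And>c x y z. f (scale c x) y z = scale c (f x y z)"
    and "\<And>x y y' z. f x (y + y') z = f x y z + f x y' z" "\<And>c x y z. f x (scale c y) z = scale c (f x y z)"
    and "\<And>x y z z'. f x y (z + z') = f x y z + f x y z'" "\<And>c x y z. f x y (scale c z) = scale c (f x y z)"
    and "\<And>x x' y z. h (x + x') y z = h x y z + h x' y z" "\<And>c x y z. h (scale c x) y z = scale c (h x y z)"
    and "\<And>x y y' z. h x (y + y') z = h x y z + h x y' z" "\<And>c x y z. h x (scale c y) z = scale c (h x y z)"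
    and "\<And>x y z z'. h x y (z + z') = h x y z + h x y z'" "\<And>c x y z. h x y (scale c z) = scale c (h x y z)"
    and basis: "\<And>i j k. i \<in> D \<Longrightarrow> j \<in> D \<Longrightarrow> k \<in> D \<Longrightarrow> f i j k = h i j k"
  shows "f x y z = h x y z"
proof -
  have 1: "f i j z = h i j z" if "i \<in> D" "j \<in> D" for i j z
    by (rule linear_eq_on_basisI[of "f i j" "h i j"]) (rule assms that | assumption)+
  have 2: "f i y z = h i y z" if "i \<in> D" for i y z
    by (rule linear_eq_on_basisI[of "\<lambda>y. f i y z" "\<lambda>y. h i y z"]) (rule assms(1-12) 1 that | assumption)+
  show ?thesis
    by (rule linear_eq_on_basisI[of "\<lambda>x. f x y z" "\<lambda>x. h x y z"]) (rule assms(1-12) 2 | assumption)+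
qed

text \<open>The vector space carries no topology, so derivatives and holomorphy of curves are defined
  coordinatewise.\<close>

definition has_coord_derivative :: "(complex \<Rightarrow> 'v) \<Rightarrow> 'v \<Rightarrow> complex \<Rightarrow> bool" where
  "has_coord_derivative X v s \<longleftrightarrow>
     (\<forall>a\<in>D. ((\<lambda>t. coord (X t) a) has_field_derivative coord v a) (at s))"

definition coord_holomorphic :: "(complex \<Rightarrow> 'v) \<Rightarrow> complex set \<Rightarrow> bool" where
  "coord_holomorphic X U \<longleftrightarrow> (\<forall>a\<in>D. (\<lambda>t. coord (X t) a) holomorphic_on U)"

lemma coord_holomorphic_const: "coord_holomorphic (\<lambda>_. v) U"
  by (simp add: coord_holomorphic_def)

lemma coord_holomorphic_sum:
  "(\<And>i. i \<in> K \<Longrightarrow> coord_holomorphic (X i) U) \<Longrightarrow> coord_holomorphic (\<lambda>t. \<Sum>i\<in>K. X i t) U"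
  by (auto simp: coord_holomorphic_def intro!: holomorphic_intros)

lemma coord_holomorphic_structure_product:
  assumes "\<And>i j l. i \<in> D \<Longrightarrow> j \<in> D \<Longrightarrow> l \<in> D \<Longrightarrow> c i j l holomorphic_on U"
    and "coord_holomorphic X U" and "coord_holomorphic Y U"
  shows "coord_holomorphic (\<lambda>t. structure_product (\<lambda>i j l. c i j l t) (X t) (Y t)) U"
  using assms unfolding coord_holomorphic_def
  by (auto simp: coord_structure_product intro!: holomorphic_intros)

lemma has_coord_derivative_structure_product:
  assumes c: "\<And>i j l. i \<in> D \<Longrightarrow> j \<in> D \<Longrightarrow> l \<in> D \<Longrightarrow> (c i j l has_field_derivative c' i j l) (at s)"
    and X: "has_coord_derivative X X' s" and Y: "has_coord_derivative Y Y' s"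
  shows "has_coord_derivative (\<lambda>t. structure_product (\<lambda>i j l. c i j l t) (X t) (Y t))
    (structure_product c' (X s) (Y s) + structure_product (\<lambda>i j l. c i j l s) X' (Y s)
      + structure_product (\<lambda>i j l. c i j l s) (X s) Y') s"
  unfolding has_coord_derivative_def
proof
  fix l assume l: "l \<in> D"
  have "((\<lambda>t. \<Sum>i\<in>D. \<Sum>j\<in>D. coord (X t) i * coord (Y t) j * c i j l t) has_field_derivative
      (\<Sum>i\<in>D. \<Sum>j\<in>D. (coord X' i * coord (Y s) j + coord Y' j * coord (X s) i) * c i j l s
        + c' i j l * (coord (X s) i * coord (Y s) j))) (at s)"
    using X Y l unfolding has_coord_derivative_def
    by (intro DERIV_sum DERIV_mult c) auto
  then show "((\<lambda>t. coord (structure_product (\<lambda>i j l. c i j l t) (X t) (Y t)) l) has_field_derivative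
      coord (structure_product c' (X s) (Y s) + structure_product (\<lambda>i j l. c i j l s) X' (Y s)
      + structure_product (\<lambda>i j l. c i j l s) (X s) Y') l) (at s)"
    using l by (simp add: coord_structure_product sum.distrib[symmetric] algebra_simps)
qed

definition fibre :: "('v \<Rightarrow> 'v \<Rightarrow> 'v \<Rightarrow> complex \<Rightarrow> complex) \<Rightarrow> 'v \<Rightarrow> complex \<Rightarrow> 'v calg" where
  "fibre g u s = \<lparr>alg_scale = scale, alg_mult = structure_product (\<lambda>i j l. g i j l s), alg_one = u\<rparr>"

lemma fibre_simps [simp]:
  "alg_scale (fibre g u s) = scale" "alg_one (fibre g u s) = u"
  by (simp_all add: fibre_def)

end

section \<open>Holomorphic families of algebras\<close>

locale holomorphic_family = coordinate_space scale D
  for scale :: "complex \<Rightarrow> 'v::ab_group_add \<Rightarrow> 'v" and D :: "'v set" +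
  fixes g :: "'v \<Rightarrow> 'v \<Rightarrow> 'v \<Rightarrow> complex \<Rightarrow> complex" and u :: 'v and U :: "complex set"
  assumes open_U: "open U"
    and g_holomorphic: "i \<in> D \<Longrightarrow> j \<in> D \<Longrightarrow> l \<in> D \<Longrightarrow> g i j l holomorphic_on U"
    and fibre_algebra: "s \<in> U \<Longrightarrow> complex_algebra (fibre g u s)"
begin

definition fmult :: "complex \<Rightarrow> 'v \<Rightarrow> 'v \<Rightarrow> 'v" where
  "fmult s = structure_product (\<lambda>i j l. g i j l s)"

definition fmult' :: "complex \<Rightarrow> 'v \<Rightarrow> 'v \<Rightarrow> 'v" where
  "fmult' s = structure_product (\<lambda>i j l. deriv (g i j l) s)"

lemma alg_mult_fibre [simp]: "alg_mult (fibre g u s) = fmult s"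
  by (simp add: fibre_def fmult_def)

lemma based_algebra_fibre: "s \<in> U \<Longrightarrow> based_algebra (fibre g u s) D"
  by (simp add: based_algebra_def fibre_algebra coordinate_space_axioms)

lemmas fmult_bilinear = structure_product_bilinear[of "\<lambda>i j l. g i j l s" for s, folded fmult_def]
lemmas fmult'_bilinear = structure_product_bilinear[of "\<lambda>i j l. deriv (g i j l) s" for s, folded fmult'_def]

lemma g_derivative:
  "s \<in> U \<Longrightarrow> i \<in> D \<Longrightarrow> j \<in> D \<Longrightarrow> l \<in> D \<Longrightarrow> (g i j l has_field_derivative deriv (g i j l) s) (at s)"
  using g_holomorphic open_U by (intro holomorphic_derivI)

lemma has_coord_derivative_fmult:
  assumes "s \<in> U" and "has_coord_derivative X X' s" and "has_coord_derivative Y Y' s"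
  shows "has_coord_derivative (\<lambda>t. fmult t (X t) (Y t))
    (fmult' s (X s) (Y s) + fmult s X' (Y s) + fmult s (X s) Y') s"
  unfolding fmult_def fmult'_def
  by (intro has_coord_derivative_structure_product g_derivative assms)

lemma coord_holomorphic_fmult:
  assumes "coord_holomorphic X W" and "coord_holomorphic Y W" and "W \<subseteq> U"
  shows "coord_holomorphic (\<lambda>t. fmult t (X t) (Y t)) W"
    and "coord_holomorphic (\<lambda>t. fmult' t (X t) (Y t)) W"
proof -
  have g: "g i j l holomorphic_on W" "deriv (g i j l) holomorphic_on W"
    if "i \<in> D" "j \<in> D" "l \<in> D" for i j l
    using g_holomorphic[OF that] holomorphic_deriv[OF g_holomorphic[OF that] open_U] assms(3)
    by (auto intro: holomorphic_on_subset)
  show "coord_holomorphic (\<lambda>t. fmult t (X t) (Y t)) W"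
    unfolding fmult_def by (intro coord_holomorphic_structure_product g assms)
  show "coord_holomorphic (\<lambda>t. fmult' t (X t) (Y t)) W"
    unfolding fmult'_def by (intro coord_holomorphic_structure_product g assms)
qed

lemma has_coord_derivative_const: "has_coord_derivative (\<lambda>_. v) 0 s"
  by (simp add: has_coord_derivative_def)

lemma has_coord_derivative_unique:
  "has_coord_derivative X v s \<Longrightarrow> has_coord_derivative X w s \<Longrightarrow> v = w"
  unfolding has_coord_derivative_def by (intro coord_eqI) (blast intro: DERIV_unique)

text \<open>Differentiating the associative law of \<open>fmult s\<close> with respect to \<open>s\<close> gives the Hochschild
  cocycle identity of the derivative.\<close>

lemma fmult'_cocycle:
  assumes s: "s \<in> U"
  shows "fmult' s (fmult s x y) z + fmult s (fmult' s x y) z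
       = fmult' s x (fmult s y z) + fmult s x (fmult' s y z)"
proof -
  have assoc: "fmult t (fmult t x y) z = fmult t x (fmult t y z)" if "t \<in> U" for t
    using complex_algebra.mult_assoc[OF fibre_algebra[OF that], of x y z] by simp
  have zero: "fmult s v 0 = 0" "fmult s 0 v = 0" for v
    using fmult_bilinear(1)[of s 0 0 v] fmult_bilinear(2)[of s v 0 0] by simp_all
  have const: "has_coord_derivative (\<lambda>t. fmult t v w) (fmult' s v w) s" for v w
    using has_coord_derivative_fmult[OF s has_coord_derivative_const has_coord_derivative_const, of v w]
    by (simp add: zero)
  have L: "has_coord_derivative (\<lambda>t. fmult t (fmult t x y) z)
      (fmult' s (fmult s x y) z + fmult s (fmult' s x y) z) s"
    using has_coord_derivative_fmult[OF s const[of x y] has_coord_derivative_const[of z]]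
    by (simp add: zero)
  have R: "has_coord_derivative (\<lambda>t. fmult t x (fmult t y z))
      (fmult' s x (fmult s y z) + fmult s x (fmult' s y z)) s"
    using has_coord_derivative_fmult[OF s has_coord_derivative_const[of x] const[of y z]]
    by (simp add: zero)
  have "has_coord_derivative (\<lambda>t. fmult t (fmult t x y) z)
      (fmult' s x (fmult s y z) + fmult s x (fmult' s y z)) s"
    unfolding has_coord_derivative_def
  proof
    fix a assume "a \<in> D"
    then have "((\<lambda>t. coord (fmult t x (fmult t y z)) a) has_field_derivative
        coord (fmult' s x (fmult s y z) + fmult s x (fmult' s y z)) a) (at s)"
      using R by (simp only: has_coord_derivative_def)
    then show "((\<lambda>t. coord (fmult t (fmult t x y) z) a) has_field_derivative
        coord (fmult' s x (fmult s y z) + fmult s x (fmult' s y z)) a) (at s)"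
      by (rule has_field_derivative_transform_within_open[OF _ open_U s]) (simp add: assoc)
  qed
  with L show ?thesis by (rule has_coord_derivative_unique)
qed

text \<open>The trace form of the fibre at \<open>s\<close>, with \<open>s\<close> as last argument because it is treated as a
  matrix of holomorphic functions of \<open>s\<close>.\<close>

definition trace_form :: "'v \<Rightarrow> 'v \<Rightarrow> complex \<Rightarrow> complex" where
  "trace_form x y s = (\<Sum>k\<in>D. coord (fmult s (fmult s x y) k) k)"

lemma trace_form_eq:
  assumes "s \<in> U"
  shows "based_algebra.reg_trace (fibre g u s) D (fmult s x y) = trace_form x y s"
proof -
  interpret N: based_algebra "fibre g u s" D by (rule based_algebra_fibre[OF assms])
  show ?thesis using N.reg_trace_def by (simp add: trace_form_def)
qed

lemma trace_form_expansion: "trace_form x y s = (\<Sum>a\<in>D. coord y a * trace_form x a s)"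
  by (rule linear_expansion[of "\<lambda>y. trace_form x y s" "(*)"])
    (simp_all add: trace_form_def fmult_bilinear sum.distrib sum_distrib_left)

lemma trace_form_holomorphic: "trace_form x y holomorphic_on U"
proof -
  have "coord_holomorphic (\<lambda>s. fmult s (fmult s x y) k) U" for k
    by (intro coord_holomorphic_fmult coord_holomorphic_const order_refl)
  then have "(\<lambda>s. \<Sum>k\<in>D. coord (fmult s (fmult s x y) k) k) holomorphic_on U"
    by (intro holomorphic_intros) (simp add: coord_holomorphic_def)
  then show ?thesis by (simp add: trace_form_def[abs_def])
qed

text \<open>Nondegeneracy of the trace form is the nonvanishing of one holomorphic function \<open>\<Delta>\<close>, the
  discriminant of the family. The adjugate \<open>S\<close> yields dual bases that depend holomorphically on \<open>s\<close>
  where \<open>\<Delta>\<close> does not vanish.\<close>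

lemma discriminant:
  obtains \<Delta> S where "\<Delta> holomorphic_on U"
    and "\<And>a j. a \<in> D \<Longrightarrow> j \<in> D \<Longrightarrow> S a j holomorphic_on U"
    and "\<And>i j s. i \<in> D \<Longrightarrow> j \<in> D \<Longrightarrow>
      (\<Sum>a\<in>D. trace_form i a s * S a j s) = (if i = j then \<Delta> s else 0)"
    and "\<And>s. s \<in> U \<Longrightarrow>
      \<Delta> s \<noteq> 0 \<longleftrightarrow> based_algebra.nondegenerate_trace_form (fibre g u s) D"
proof -
  obtain \<Delta> S where \<Delta>: "\<Delta> holomorphic_on U"
    and S: "\<And>a j. a \<in> D \<Longrightarrow> j \<in> D \<Longrightarrow> S a j holomorphic_on U"
    and TS: "\<And>i j s. i \<in> D \<Longrightarrow> j \<in> D \<Longrightarrow>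
      (\<Sum>a\<in>D. trace_form i a s * S a j s) = (if i = j then \<Delta> s else 0)"
    and ker: "\<And>s. \<Delta> s = 0 \<Longrightarrow>
      \<exists>v. (\<exists>p\<in>D. v p \<noteq> 0) \<and> (\<forall>p\<in>D. (\<Sum>q\<in>D. trace_form p q s * v q) = 0)"
    by (rule holomorphic_adjugate[of D trace_form U, OF finite_Basis trace_form_holomorphic])
      (rule that)
  have "\<Delta> s \<noteq> 0 \<longleftrightarrow> based_algebra.nondegenerate_trace_form (fibre g u s) D" if s: "s \<in> U" for s
  proof -
    interpret N: based_algebra "fibre g u s" D by (rule based_algebra_fibre[OF s])
    have commute: "trace_form x y s = trace_form y x s" for x y
      using N.reg_trace_commute[of x y] by (simp add: trace_form_eq s)
    have nondegenerate_iff: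
      "N.nondegenerate_trace_form \<longleftrightarrow> (\<forall>x. (\<forall>y. trace_form x y s = 0) \<longrightarrow> x = 0)"
      by (simp add: N.nondegenerate_trace_form_def trace_form_eq s)
    show ?thesis
      unfolding nondegenerate_iff
    proof (intro iffI allI impI notI)
      fix x assume "\<Delta> s \<noteq> 0" and x: "\<forall>y. trace_form x y s = 0"
      have "coord x j = 0" if j: "j \<in> D" for j
      proof -
        have "0 = (\<Sum>a\<in>D. trace_form a x s * S a j s)"
          using x by (simp add: commute[of _ x])
        also have "\<dots> = (\<Sum>a\<in>D. \<Sum>i\<in>D. coord x i * (trace_form i a s * S a j s))"
        proof (intro sum.cong refl)
          fix a
          show "trace_form a x s * S a j s
              = (\<Sum>i\<in>D. coord x i * (trace_form i a s * S a j s))"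
            by (subst trace_form_expansion, subst commute)
              (simp add: sum_distrib_right mult.assoc)
        qed
        also have "\<dots> = (\<Sum>i\<in>D. coord x i * (\<Sum>a\<in>D. trace_form i a s * S a j s))"
          by (subst sum.swap) (simp add: sum_distrib_left)
        also have "\<dots> = coord x j * \<Delta> s"
          using j finite_Basis by (simp add: TS if_distrib[of "\<lambda>t. _ * t"] cong: if_cong)
        finally show ?thesis using \<open>\<Delta> s \<noteq> 0\<close> by simp
      qed
      then show "x = 0" by (intro coord_eqI) simp
    next
      assume nd: "\<forall>x. (\<forall>y. trace_form x y s = 0) \<longrightarrow> x = 0" and "\<Delta> s = 0"
      obtain v where v: "\<exists>p\<in>D. v p \<noteq> 0"
          "\<And>p. p \<in> D \<Longrightarrow> (\<Sum>q\<in>D. trace_form p q s * v q) = 0"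
        using ker[OF \<open>\<Delta> s = 0\<close>] by blast
      define x where "x = (\<Sum>q\<in>D. scale (v q) q)"
      have coord_x: "coord x q = v q" if "q \<in> D" for q
        unfolding x_def by (rule coord_combination[OF that])
      have "trace_form p x s = 0" if "p \<in> D" for p
        using v(2)[OF that] by (subst trace_form_expansion) (simp add: coord_x mult.commute)
      then have "trace_form x y s = 0" for y
        by (subst trace_form_expansion) (simp add: commute[of x])
      then have "x = 0" using nd by simp
      then show False using v(1) coord_x by auto
    qed
  qed
  with \<Delta> S TS show ?thesis by (rule that)
qed

text \<open>The derivative of the product is a coboundary near \<open>s0\<close>, of a cochain that depends
  holomorphically on \<open>s\<close>. This is the input for the differential equation below.\<close>

lemma local_splitting:
  assumes s0: "s0 \<in> U" and nd: "based_algebra.nondegenerate_trace_form (fibre g u s0) D"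
  obtains W f where "open W" "s0 \<in> W" "W \<subseteq> U"
    and "\<And>x. coord_holomorphic (\<lambda>s. f s x) W"
    and "\<And>s x y. f s (x + y) = f s x + f s y" and "\<And>s c x. f s (scale c x) = scale c (f s x)"
    and "\<And>s x y. s \<in> W \<Longrightarrow> fmult' s x y = fmult s (f s x) y + fmult s x (f s y) - f s (fmult s x y)"
proof -
  obtain \<Delta> S where \<Delta>: "\<Delta> holomorphic_on U"
    and S: "\<And>a j. a \<in> D \<Longrightarrow> j \<in> D \<Longrightarrow> S a j holomorphic_on U"
    and TS: "\<And>i j s. i \<in> D \<Longrightarrow> j \<in> D \<Longrightarrow> (\<Sum>a\<in>D. trace_form i a s * S a j s) = (if i = j then \<Delta> s else 0)"
    and \<Delta>_nz: "\<And>s. s \<in> U \<Longrightarrow>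
      \<Delta> s \<noteq> 0 \<longleftrightarrow> based_algebra.nondegenerate_trace_form (fibre g u s) D"
    by (rule discriminant) (rule that)
  define W where "W = U \<inter> \<Delta> -` (- {0})"
  have "open W"
    unfolding W_def by (rule continuous_open_preimage[OF holomorphic_on_imp_continuous_on[OF \<Delta>] open_U])
      (rule open_Compl[OF closed_singleton])
  have W: "W \<subseteq> U" "\<And>s. s \<in> W \<Longrightarrow> \<Delta> s \<noteq> 0" by (auto simp: W_def)
  define dual where "dual s j = (\<Sum>a\<in>D. scale (S a j s / \<Delta> s) a)" for s j
  define f where "f s x = (\<Sum>i\<in>D. fmult s i (fmult' s (dual s i) x))" for s x
  have coord_dual: "coord (dual s j) a = S a j s / \<Delta> s" if "a \<in> D" for s j a
    unfolding dual_def by (rule coord_combination[OF that])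
  have dual_holo: "coord_holomorphic (\<lambda>s. dual s j) W" if "j \<in> D" for j
    unfolding coord_holomorphic_def
  proof
    fix a assume a: "a \<in> D"
    have "(\<lambda>s. S a j s / \<Delta> s) holomorphic_on W"
      using S[OF a that] \<Delta> W by (intro holomorphic_intros) (auto intro: holomorphic_on_subset)
    then show "(\<lambda>s. coord (dual s j) a) holomorphic_on W" by (simp add: coord_dual[OF a])
  qed
  have f_holo: "coord_holomorphic (\<lambda>s. f s x) W" for x
    unfolding f_def
    by (intro coord_holomorphic_sum coord_holomorphic_fmult dual_holo coord_holomorphic_const W(1))
  have f_add: "f s (x + y) = f s x + f s y" for s x y
    by (simp add: f_def fmult_bilinear fmult'_bilinear sum.distrib)
  have f_scale: "f s (scale c x) = scale c (f s x)" for s c x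
    by (simp add: f_def fmult_bilinear fmult'_bilinear scale_sum_right)
  have split: "fmult' s x y = fmult s (f s x) y + fmult s x (f s y) - f s (fmult s x y)"
    if s: "s \<in> W" for s x y
  proof -
    interpret N: based_algebra "fibre g u s" D by (rule based_algebra_fibre) (use s W in auto)
    have dual: "N.reg_trace (alg_mult (fibre g u s) i (dual s j)) = (if i = j then 1 else 0)"
      if "i \<in> D" "j \<in> D" for i j
    proof -
      have "N.reg_trace (alg_mult (fibre g u s) i (dual s j)) = trace_form i (dual s j) s"
        using s W by (simp add: trace_form_eq subset_iff)
      also have "\<dots> = (\<Sum>a\<in>D. trace_form i a s * S a j s) / \<Delta> s"
        by (subst trace_form_expansion) (simp add: coord_dual sum_divide_distrib mult.commute)
      finally show ?thesis using TS[OF that] W(2)[OF s] by simp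
    qed
    have f_eq: "N.splitting (dual s) (fmult' s) = f s"
      by (rule ext) (simp add: N.splitting_def[OF dual] f_def)
    have "fmult' s x y = alg_mult (fibre g u s) (N.splitting (dual s) (fmult' s) x) y
        + alg_mult (fibre g u s) x (N.splitting (dual s) (fmult' s) y)
        - N.splitting (dual s) (fmult' s) (alg_mult (fibre g u s) x y)"
      by (rule N.cocycle_splits[OF dual])
        (use s W in \<open>auto simp: fmult'_bilinear fmult'_cocycle\<close>)
    then show ?thesis by (simp add: f_eq)
  qed
  show ?thesis
    by (rule that[of W f])
      (use \<open>open W\<close> W s0 nd \<Delta>_nz[OF s0] f_holo f_add f_scale split in \<open>auto simp: W_def\<close>)
qed

text \<open>With \<open>f\<close> as in the preceding lemma, let \<open>X i\<close> solve \<open>X' = - f\<^sub>s X\<close> with initial value the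
  basis vector \<open>i\<close>. If \<open>X\<close> and \<open>Y\<close> solve the equation, so does \<open>m\<^sub>s(X, Y)\<close>:
  its derivative is \<open>m'\<^sub>s(X, Y) - m\<^sub>s(f\<^sub>s X, Y) - m\<^sub>s(X, f\<^sub>s Y)\<close>, which is \<open>- f\<^sub>s(m\<^sub>s(X, Y))\<close> by the choice
  of \<open>f\<close>. Thus the linear map \<open>i \<mapsto> X i s\<close> carries the product at \<open>s0\<close> to the product
  at \<open>s\<close>. Instead of a uniqueness theorem for solutions, the proof uses the solutions \<open>\<psi>\<close> of the
  adjoint equation \<open>\<psi>' = \<psi> f\<^sub>s\<close>: their pairings with solutions of the first equation are constant, so
  they recover the coordinates of the initial value. This also shows that the map is injective.\<close>

lemma local_triviality:
  assumes s0: "s0 \<in> U" and nd: "based_algebra.nondegenerate_trace_form (fibre g u s0) D"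
  obtains r where "r > 0" "ball s0 r \<subseteq> U"
    and "\<And>s. s \<in> ball s0 r \<Longrightarrow> alg_isomorphic (fibre g u s0) (fibre g u s)"
proof -
  obtain W f where W: "open W" "s0 \<in> W" "W \<subseteq> U"
    and f_holo: "\<And>x. coord_holomorphic (\<lambda>s. f s x) W"
    and f_add: "\<And>s x y. f s (x + y) = f s x + f s y"
    and f_scale: "\<And>s c x. f s (scale c x) = scale c (f s x)"
    and split: "\<And>s x y. s \<in> W \<Longrightarrow>
      fmult' s x y = fmult s (f s x) y + fmult s x (f s y) - f s (fmult s x y)"
    by (rule local_splitting[OF assms]) (rule that)
  define F where "F p q s = coord (f s q) p" for p q s
  have F_holo: "F p q holomorphic_on W" if "p \<in> D" for p q
    using f_holo[of q] that by (simp add: F_def[abs_def] coord_holomorphic_def)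
  have coord_f: "coord (f s x) p = (\<Sum>q\<in>D. coord x q * F p q s)" for s x p
    unfolding F_def
    by (rule linear_expansion[of "\<lambda>x. coord (f s x) p" "(*)"]) (simp_all add: f_add f_scale)

  obtain r1 where r1: "r1 > 0" "ball s0 r1 \<subseteq> W"
    and flow: "\<And>y0. \<exists>y. \<forall>p\<in>D. y p s0 = y0 p \<and> (\<forall>s\<in>ball s0 r1.
        (y p has_field_derivative (\<Sum>q\<in>D. - F p q s * y q s)) (at s))"
    by (rule linear_ode_solvable[of D W s0 "\<lambda>p q s. - F p q s",
          OF finite_Basis W(1,2) holomorphic_on_minus[OF F_holo]], assumption) (rule that)
  obtain r2 where r2: "r2 > 0" "ball s0 r2 \<subseteq> W"
    and coflow: "\<And>y0. \<exists>y. \<forall>p\<in>D. y p s0 = y0 p \<and> (\<forall>s\<in>ball s0 r2.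
        (y p has_field_derivative (\<Sum>q\<in>D. F q p s * y q s)) (at s))"
    by (rule linear_ode_solvable[of D W s0 "\<lambda>p q. F q p", OF finite_Basis W(1,2) F_holo], assumption) (rule that)
  define r where "r = min r1 r2"
  have r: "r > 0" "ball s0 r \<subseteq> W" and r12: "ball s0 r \<subseteq> ball s0 r1" "ball s0 r \<subseteq> ball s0 r2"
    using r1 r2 by (auto simp: r_def)

  \<comment> \<open>Coordinate solutions of the first system are assembled into curves of vectors.\<close>
  have "\<exists>X. X s0 = x \<and> (\<forall>s\<in>ball s0 r. has_coord_derivative X (- f s (X s)) s)" for x
  proof -
    obtain y where y: "\<And>p. p \<in> D \<Longrightarrow> y p s0 = coord x p"
      "\<And>p s. p \<in> D \<Longrightarrow> s \<in> ball s0 r1 \<Longrightarrow>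
          (y p has_field_derivative (\<Sum>q\<in>D. - F p q s * y q s)) (at s)"
      using flow[of "coord x"] by blast
    define X where "X s = (\<Sum>p\<in>D. scale (y p s) p)" for s
    have coord_X: "coord (X s) p = y p s" if "p \<in> D" for s p
      unfolding X_def by (rule coord_combination[OF that])
    have "X s0 = x" by (rule coord_eqI) (simp add: coord_X y)
    moreover have "has_coord_derivative X (- f s (X s)) s" if "s \<in> ball s0 r" for s
      unfolding has_coord_derivative_def
    proof
      fix a assume a: "a \<in> D"
      have "(\<Sum>q\<in>D. - F a q s * y q s) = coord (- f s (X s)) a"
        by (simp add: coord_f coord_X sum_negf mult.commute)
      with y(2)[OF a, of s] that r12 show "((\<lambda>t. coord (X t) a) has_field_derivative coord (- f s (X s)) a) (at s)"
        by (auto simp: coord_X[OF a])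
    qed
    ultimately show ?thesis by blast
  qed
  then obtain X where X0: "\<And>x. X x s0 = x"
    and X: "\<And>x s. s \<in> ball s0 r \<Longrightarrow> has_coord_derivative (X x) (- f s (X x s)) s"
    by metis

  have "\<exists>y. \<forall>p\<in>D. y p s0 = (if p = b then 1 else 0) \<and> (\<forall>s\<in>ball s0 r2.
        (y p has_field_derivative (\<Sum>q\<in>D. F q p s * y q s)) (at s))" for b
    by (rule coflow)
  then obtain \<psi> where \<psi>0: "\<And>b p. p \<in> D \<Longrightarrow> \<psi> b p s0 = (if p = b then 1 else 0)"
    and \<psi>': "\<And>b p s. p \<in> D \<Longrightarrow> s \<in> ball s0 r2 \<Longrightarrow>
        (\<psi> b p has_field_derivative (\<Sum>q\<in>D. F q p s * \<psi> b q s)) (at s)"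
    by metis
  define pair where "pair b s v = (\<Sum>p\<in>D. \<psi> b p s * coord v p)" for b s v
  have pair_add: "pair b s (v + w) = pair b s v + pair b s w" for b s v w
    by (simp add: pair_def sum.distrib algebra_simps)
  have pair_scale: "pair b s (scale c v) = c * pair b s v" for b s c v
    by (simp add: pair_def sum_distrib_left mult_ac)
  have pair_sum: "pair b s (\<Sum>i\<in>K. h i) = (\<Sum>i\<in>K. pair b s (h i))" for b s K and h :: "'v \<Rightarrow> 'v"
    unfolding pair_def coord_sum sum_distrib_left by (rule sum.swap)
  have pair_s0: "pair b s0 v = coord v b" if "b \<in> D" for b v
    using that finite_Basis by (simp add: pair_def \<psi>0 if_distrib[of "\<lambda>x. x * _"] cong: if_cong)
  \<comment> \<open>A pairing of a covector solution with a vector solution has derivative zero: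
    the two contributions of \<open>f\<close> cancel.\<close>
  have pair_const: "pair b s (Y s) = coord (Y s0) b"
    if b: "b \<in> D" and s: "s \<in> ball s0 r"
      and Y: "\<And>s. s \<in> ball s0 r \<Longrightarrow> has_coord_derivative Y (- f s (Y s)) s" for b s Y
  proof -
    have "((\<lambda>s. pair b s (Y s)) has_field_derivative 0) (at s within ball s0 r)" if s: "s \<in> ball s0 r" for s
    proof -
      have "((\<lambda>s. pair b s (Y s)) has_field_derivative
          (\<Sum>p\<in>D. (\<Sum>q\<in>D. F q p s * \<psi> b q s) * coord (Y s) p + coord (- f s (Y s)) p * \<psi> b p s)) (at s)"
        unfolding pair_def
        using Y[OF s] s r12 by (intro DERIV_sum DERIV_mult \<psi>') (auto simp: has_coord_derivative_def)
      also have "(\<Sum>p\<in>D. (\<Sum>q\<in>D. F q p s * \<psi> b q s) * coord (Y s) p + coord (- f s (Y s)) p * \<psi> b p s)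
          = (\<Sum>p\<in>D. \<Sum>q\<in>D. F q p s * \<psi> b q s * coord (Y s) p)
            - (\<Sum>p\<in>D. \<Sum>q\<in>D. F p q s * \<psi> b p s * coord (Y s) q)"
        by (simp add: coord_f sum.distrib sum_negf sum_distrib_left sum_distrib_right sum_subtractf mult_ac)
      also have "\<dots> = 0"
        by (subst sum.swap) simp
      finally show ?thesis by (rule has_field_derivative_at_within)
    qed
    then obtain c where "\<And>s. s \<in> ball s0 r \<Longrightarrow> pair b s (Y s) = c"
      using has_field_derivative_zero_constant[OF convex_ball] by metis
    then have "pair b s (Y s) = pair b s0 (Y s0)" using s r(1) by simp
    then show ?thesis using pair_s0[OF b] by simp
  qed

  have "alg_isomorphic (fibre g u s0) (fibre g u s)" if s: "s \<in> ball s0 r" for s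
  proof -
    have sU: "s \<in> U" using s r W by auto
    define \<phi> where "\<phi> x = (\<Sum>i\<in>D. scale (coord x i) (X i s))" for x
    have \<phi>_add: "\<phi> (x + y) = \<phi> x + \<phi> y" for x y
      by (simp add: \<phi>_def scale_left_distrib sum.distrib)
    have \<phi>_scale: "\<phi> (scale c x) = scale c (\<phi> x)" for c x
      by (simp add: \<phi>_def scale_sum_right)
    have \<phi>_basis: "\<phi> i = X i s" if "i \<in> D" for i
      using that finite_Basis by (simp add: \<phi>_def coord_basis if_distrib[of "\<lambda>c. scale c _"] cong: if_cong)
    have linear: "Vector_Spaces.linear scale scale \<phi>"
      unfolding Vector_Spaces.linear_iff using \<phi>_add \<phi>_scale vector_space_axioms by blast
    have pair_\<phi>: "pair b s (\<phi> x) = coord x b" if "b \<in> D" for b x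
    proof -
      have "pair b s (\<phi> x) = (\<Sum>i\<in>D. coord x i * pair b s (X i s))"
        unfolding \<phi>_def by (simp add: pair_sum pair_scale)
      also have "\<dots> = (\<Sum>i\<in>D. coord x i * coord i b)"
        using pair_const[OF that s X] by (simp add: X0)
      also have "\<dots> = coord x b"
        using that finite_Basis by (simp add: coord_basis if_distrib cong: if_cong)
      finally show ?thesis .
    qed
    \<comment> \<open>The functionals \<open>pair b s\<close> are a left inverse of \<open>\<phi>\<close> in coordinates, so
      \<open>\<phi>\<close> is bijective and they separate vectors.\<close>
    have "inj \<phi>"
      by (rule injI, rule coord_eqI) (metis pair_\<phi>)
    then have "surj \<phi>" by (rule linear_inj_imp_surj[OF linear])
    have pair_eqI: "v = w" if "\<And>b. b \<in> D \<Longrightarrow> pair b s v = pair b s w" for v w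
    proof -
      obtain x y where "v = \<phi> x" "w = \<phi> y" using \<open>surj \<phi>\<close> by (metis surjD)
      then show ?thesis using that by (simp add: pair_\<phi>) (metis coord_eqI)
    qed
    have pair_mult: "pair b s (fmult s (X i s) (X j s)) = coord (fmult s0 i j) b" if "b \<in> D" for b i j
    proof -
      have "has_coord_derivative (\<lambda>t. fmult t (X i t) (X j t)) (- f t (fmult t (X i t) (X j t))) t"
        if t: "t \<in> ball s0 r" for t
      proof -
        have tW: "t \<in> W" "t \<in> U" using t r W by auto
        have neg: "fmult t (- x) y = - fmult t x y" "fmult t x (- y) = - fmult t x y" for x y
          using fmult_bilinear(3)[of t "-1" x y] fmult_bilinear(4)[of t x "-1" y] by simp_all
        show ?thesis
          using has_coord_derivative_fmult[OF tW(2) X[OF t] X[OF t], of i j]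
          by (simp add: split[OF tW(1)] neg)
      qed
      from pair_const[OF that s this] show ?thesis by (simp add: X0)
    qed
    have mult: "\<phi> (fmult s0 x y) = fmult s (\<phi> x) (\<phi> y)" for x y
    proof -
      have basis: "\<phi> (fmult s0 i j) = fmult s (\<phi> i) (\<phi> j)" if "i \<in> D" "j \<in> D" for i j
        by (rule pair_eqI) (simp add: pair_\<phi> \<phi>_basis that pair_mult)
      have partial: "\<phi> (fmult s0 i y) = fmult s (\<phi> i) (\<phi> y)" if "i \<in> D" for i y
        by (rule linear_eq_on_basisI[of "\<lambda>y. \<phi> (fmult s0 i y)" "\<lambda>y. fmult s (\<phi> i) (\<phi> y)"])
          (simp_all add: \<phi>_add \<phi>_scale fmult_bilinear basis that)
      show ?thesis
        by (rule linear_eq_on_basisI[of "\<lambda>x. \<phi> (fmult s0 x y)" "\<lambda>x. fmult s (\<phi> x) (\<phi> y)"])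
          (simp_all add: \<phi>_add \<phi>_scale fmult_bilinear partial)
    qed
    show ?thesis
      by (rule alg_isomorphicI[of _ _ \<phi>])
        (use linear \<open>inj \<phi>\<close> \<open>surj \<phi>\<close> mult fibre_algebra s0 sU in \<open>auto simp: bij_def\<close>)
  qed
  then show ?thesis using r W by (intro that[of r]) auto
qed

end

section \<open>Specialisations of a formal deformation\<close>

locale based_deformation = formal_deformation N circ + coordinate_space "alg_scale N" D
  for N :: "'v::ab_group_add calg" and D :: "'v set" and circ :: "'v fps \<Rightarrow> 'v fps \<Rightarrow> 'v fps"
begin

abbreviation G :: "'v \<Rightarrow> 'v \<Rightarrow> 'v \<Rightarrow> complex fps" where
  "G \<equiv> struct_coeff N D circ"

text \<open>Coordinates over the ring of power series: \<open>N{t}\<close> is free over it with basis \<open>D\<close>.\<close>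

definition fps_coord :: "'v fps \<Rightarrow> 'v \<Rightarrow> complex fps" where
  "fps_coord x l = Abs_fps (\<lambda>n. coord (fps_nth x n) l)"

lemma struct_coeff_eq: "G i j l = fps_coord (circ (fps_const i) (fps_const j)) l"
  by (simp add: struct_coeff_def fps_coord_def)

lemma fps_coord_const: "fps_coord (fps_const v) l = fps_const (coord v l)"
  by (rule fps_ext) (simp add: fps_coord_def)

lemma fps_coord_sum_scale:
  "fps_coord (\<Sum>a\<in>K. fps_scale (alg_scale N) (f a) (x a)) l = (\<Sum>a\<in>K. f a * fps_coord (x a) l)"
  by (rule fps_ext) (simp add: fps_coord_def fps_scale_def fps_sum_nth fps_mult_nth)

lemma fps_expansion_in_basis:
  "x = (\<Sum>a\<in>D. fps_scale (alg_scale N) (fps_coord x a) (fps_const a))"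
proof (rule fps_ext)
  fix k
  have "fps_nth (fps_scale (alg_scale N) f (fps_const a)) k = alg_scale N (fps_nth f k) a" for f a
  proof -
    have "(\<Sum>m=0..k. alg_scale N (fps_nth f m) (fps_nth (fps_const a) (k - m)))
        = (\<Sum>m=0..k. if m = k then alg_scale N (fps_nth f k) a else 0)"
      by (rule sum.cong) auto
    then show ?thesis by (simp add: fps_scale_def)
  qed
  then show "fps_nth x k = fps_nth (\<Sum>a\<in>D. fps_scale (alg_scale N) (fps_coord x a) (fps_const a)) k"
    by (simp add: fps_sum_nth fps_coord_def coord_expansion)
qed

lemma circ_sum_scale:
  "finite K \<Longrightarrow> circ (\<Sum>a\<in>K. fps_scale (alg_scale N) (f a) (x a)) y
    = (\<Sum>a\<in>K. fps_scale (alg_scale N) (f a) (circ (x a) y))"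
  "finite K \<Longrightarrow> circ y (\<Sum>a\<in>K. fps_scale (alg_scale N) (f a) (x a))
    = (\<Sum>a\<in>K. fps_scale (alg_scale N) (f a) (circ y (x a)))"
proof -
  have zero: "circ 0 y = 0" "circ y 0 = 0"
    using circ_add_left[of 0 0 y] circ_add_right[of y 0 0] by simp_all
  show "finite K \<Longrightarrow> circ (\<Sum>a\<in>K. fps_scale (alg_scale N) (f a) (x a)) y
      = (\<Sum>a\<in>K. fps_scale (alg_scale N) (f a) (circ (x a) y))"
    by (induction rule: finite_induct) (simp_all add: zero circ_add_left circ_scale_left)
  show "finite K \<Longrightarrow> circ y (\<Sum>a\<in>K. fps_scale (alg_scale N) (f a) (x a))
      = (\<Sum>a\<in>K. fps_scale (alg_scale N) (f a) (circ y (x a)))"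
    by (induction rule: finite_induct) (simp_all add: zero circ_add_right circ_scale_right)
qed

lemma fps_coord_circ:
  "fps_coord (circ x y) l = (\<Sum>a\<in>D. fps_coord x a * fps_coord (circ (fps_const a) y) l)"
  "fps_coord (circ x y) l = (\<Sum>a\<in>D. fps_coord y a * fps_coord (circ x (fps_const a)) l)"
proof -
  have "circ x y = (\<Sum>a\<in>D. fps_scale (alg_scale N) (fps_coord x a) (circ (fps_const a) y))"
    by (subst (1) fps_expansion_in_basis[of x]) (rule circ_sum_scale[OF finite_Basis])
  then show "fps_coord (circ x y) l = (\<Sum>a\<in>D. fps_coord x a * fps_coord (circ (fps_const a) y) l)"
    by (simp add: fps_coord_sum_scale)
  have "circ x y = (\<Sum>a\<in>D. fps_scale (alg_scale N) (fps_coord y a) (circ x (fps_const a)))"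
    by (subst (1) fps_expansion_in_basis[of y]) (rule circ_sum_scale[OF finite_Basis])
  then show "fps_coord (circ x y) l = (\<Sum>a\<in>D. fps_coord y a * fps_coord (circ x (fps_const a)) l)"
    by (simp add: fps_coord_sum_scale)
qed

text \<open>Associativity and the unit law of the deformed product, expressed as identities between power
  series; only in this form can they be evaluated at a parameter.\<close>

lemma struct_coeff_assoc: "(\<Sum>a\<in>D. G i j a * G a k l) = (\<Sum>a\<in>D. G j k a * G i a l)"
  using circ_assoc[of "fps_const i" "fps_const j" "fps_const k"]
    fps_coord_circ(1)[of "circ (fps_const i) (fps_const j)" "fps_const k" l]
    fps_coord_circ(2)[of "fps_const i" "circ (fps_const j) (fps_const k)" l]
  by (simp add: struct_coeff_eq)

lemma struct_coeff_unit:
  "(\<Sum>a\<in>D. fps_const (coord (alg_one N) a) * G a j l) = fps_const (coord j l)"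
  "(\<Sum>a\<in>D. fps_const (coord (alg_one N) a) * G j a l) = fps_const (coord j l)"
  using fps_coord_circ(1)[of "fps_const (alg_one N)" "fps_const j" l]
    fps_coord_circ(2)[of "fps_const j" "fps_const (alg_one N)" l]
  by (simp_all add: struct_coeff_eq circ_one_left circ_one_right fps_coord_const)

abbreviation g :: "'v \<Rightarrow> 'v \<Rightarrow> 'v \<Rightarrow> complex \<Rightarrow> complex" where
  "g i j l \<equiv> eval_fps (G i j l)"

lemma specialisation_eq_fibre: "specialisation N D circ s = fibre g (alg_one N) s"
  by (simp add: specialisation_def fibre_def structure_product_def fun_eq_iff)

text \<open>Evaluation at \<open>s\<close> respects sums and products of power series whose discs of convergence contain
  \<open>s\<close>, so the identities between the structure coefficients pass to the specialisation.\<close>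

lemma fibre_complex_algebra:
  assumes radius: "\<And>i j l. i \<in> D \<Longrightarrow> j \<in> D \<Longrightarrow> l \<in> D \<Longrightarrow> ereal (norm s) < fps_conv_radius (G i j l)"
  shows "complex_algebra (fibre g (alg_one N) s)"
proof -
  define m where "m = structure_product (\<lambda>i j l. g i j l s)"
  note m_bilinear = structure_product_bilinear[of "\<lambda>i j l. g i j l s", folded m_def]
  note coord_m = coord_structure_product_basis[where c = "\<lambda>i j l. g i j l s", folded m_def]
  have assoc_basis: "m (m i j) k = m i (m j k)" if "i \<in> D" "j \<in> D" "k \<in> D" for i j k
  proof (rule coord_eqI)
    fix l assume l: "l \<in> D"
    have "coord (m (m i j) k) l = (\<Sum>a\<in>D. g i j a s * g a k l s)"
      by (simp add: coord_m(2)[OF l that(3)] coord_m(3) that)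
    also have "\<dots> = eval_fps (\<Sum>a\<in>D. G i j a * G a k l) s"
      using that l by (simp add: eval_fps_sum_mult radius)
    also have "\<dots> = eval_fps (\<Sum>a\<in>D. G j k a * G i a l) s"
      by (simp only: struct_coeff_assoc)
    also have "\<dots> = (\<Sum>a\<in>D. g j k a s * g i a l s)"
      using that l by (simp add: eval_fps_sum_mult radius)
    also have "\<dots> = coord (m i (m j k)) l"
      by (simp add: coord_m(1)[OF l that(1)] coord_m(3) that)
    finally show "coord (m (m i j) k) l = coord (m i (m j k)) l" .
  qed
  have assoc: "m (m x y) z = m x (m y z)" for x y z
    by (rule trilinear_eq_on_basisI[of "\<lambda>x y z. m (m x y) z" "\<lambda>x y z. m x (m y z)"])
      (simp_all add: m_bilinear assoc_basis)
  have unit_basis: "m (alg_one N) j = j" "m j (alg_one N) = j" if j: "j \<in> D" for j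
  proof (safe intro!: coord_eqI)
    fix l assume l: "l \<in> D"
    have "coord (m (alg_one N) j) l = eval_fps (\<Sum>a\<in>D. fps_const (coord (alg_one N) a) * G a j l) s"
      using j l by (simp add: coord_m eval_fps_sum_mult radius)
    then show "coord (m (alg_one N) j) l = coord j l"
      by (simp add: struct_coeff_unit)
    have "coord (m j (alg_one N)) l = eval_fps (\<Sum>a\<in>D. fps_const (coord (alg_one N) a) * G j a l) s"
      using j l by (simp add: coord_m eval_fps_sum_mult radius)
    then show "coord (m j (alg_one N)) l = coord j l"
      by (simp add: struct_coeff_unit)
  qed
  have unit: "m (alg_one N) x = x" "m x (alg_one N) = x" for x
    by (rule linear_eq_on_basisI[of "m (alg_one N)" "\<lambda>x. x"] linear_eq_on_basisI[of "\<lambda>x. m x (alg_one N)" "\<lambda>x. x"];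
        simp add: m_bilinear unit_basis)+
  show ?thesis
    unfolding complex_algebra_def complex_algebra_axioms_def fibre_def calg.simps m_def[symmetric]
    using vector_space_axioms by (simp add: m_bilinear assoc unit)
qed

lemma holomorphic_family_fibre:
  assumes radius: "\<And>i j l. i \<in> D \<Longrightarrow> j \<in> D \<Longrightarrow> l \<in> D \<Longrightarrow> fps_conv_radius (G i j l) \<ge> ereal c"
  shows "holomorphic_family (alg_scale N) D g (alg_one N) (ball 0 c)"
proof (intro holomorphic_family.intro holomorphic_family_axioms.intro coordinate_space_axioms)
  show "g i j l holomorphic_on ball 0 c" if "i \<in> D" "j \<in> D" "l \<in> D" for i j l
    using ball_eball_mono radius[OF that]
    by (intro holomorphic_on_eval_fps) (auto simp: in_eball_iff intro: less_le_trans)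
  show "complex_algebra (fibre g (alg_one N) s)" if "s \<in> ball 0 c" for s
    by (rule fibre_complex_algebra, rule less_le_trans[OF _ radius]) (use that in auto)
qed simp

end

section \<open>Strongly flat deformations to semisimple algebras\<close>

lemma strongly_flat_deformation_nearby:
  assumes "strongly_flat_deformation N D circ B" and "\<epsilon> > 0"
  obtains s :: real where "0 < s" "s < \<epsilon>" "alg_isomorphic (specialisation N D circ (of_real s)) B"
  using assms unfolding strongly_flat_deformation_def by blast

theorem proposition1:
  fixes N :: "('n::ab_group_add) calg" and D :: "'n set"
    and circ :: "'n fps \<Rightarrow> 'n fps \<Rightarrow> 'n fps"
    and A :: "('a::ab_group_add) calg"
  assumes "fin_dim_algebra N"
    and "finite_dimensional_vector_space (alg_scale N) D"
    and "fin_dim_algebra A" and "semisimple_algebra A"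
    and "alg_dim A = alg_dim N"
    and "strongly_flat_deformation N D circ A"
  shows "(\<exists>\<delta>::real. \<delta> > 0 \<and>
            (\<forall>s::real. 0 < s \<and> s < \<delta> \<longrightarrow>
               struct_coeffs_converge N D circ (of_real s) \<and>
               alg_isomorphic (specialisation N D circ (of_real s)) A)) \<and>
         (\<forall>B :: ('b::ab_group_add) calg.
            complex_algebra B \<and> semisimple_algebra B \<and> strongly_flat_deformation N D circ B \<longrightarrow>
            alg_isomorphic A B)"
proof -
  have flat: "formal_deformation N circ"
    using assms(6) by (simp add: strongly_flat_deformation_def)
  interpret based_deformation N D circ
    using flat assms(2) by (simp add: based_deformation_def coordinate_space_def)
  obtain c t0 :: real where "c > 0"
    and conv: "\<And>s::real. 0 \<le> s \<Longrightarrow> s < c \<Longrightarrow> struct_coeffs_converge N D circ (of_real s)"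
    and t0: "0 < t0" "t0 < c" "alg_isomorphic (specialisation N D circ (of_real t0)) A"
    using assms(6) unfolding strongly_flat_deformation_def by blast
  \<comment> \<open>Convergence on the real interval \<open>[0, c)\<close> implies convergence on the complex disc of radius \<open>c\<close>.\<close>
  have radius: "fps_conv_radius (G i j l) \<ge> ereal c" if "i \<in> D" "j \<in> D" "l \<in> D" for i j l
    unfolding fps_conv_radius_def
  proof (rule conv_radius_geI_ex)
    fix r :: real assume "0 < r" "ereal r < ereal c"
    then show "\<exists>z. norm z = r \<and> summable (\<lambda>n. fps_nth (G i j l) n * z ^ n)"
      using conv[of r] that by (intro exI[of _ "of_real r"]) (auto simp: struct_coeffs_converge_def)
  qed
  interpret F: holomorphic_family "alg_scale N" D g "alg_one N" "ball 0 c"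
    by (rule holomorphic_family_fibre[OF radius])
  let ?F = "\<lambda>s::real. fibre g (alg_one N) (of_real s)"

  obtain \<Delta> S where \<Delta>: "\<Delta> holomorphic_on ball 0 c"
    and "\<And>a j. a \<in> D \<Longrightarrow> j \<in> D \<Longrightarrow> S a j holomorphic_on ball 0 c"
    and "\<And>i j s. i \<in> D \<Longrightarrow> j \<in> D \<Longrightarrow>
      (\<Sum>a\<in>D. F.trace_form i a s * S a j s) = (if i = j then \<Delta> s else 0)"
    and \<Delta>_iff: "\<And>s. s \<in> ball 0 c \<Longrightarrow>
      \<Delta> s \<noteq> 0 \<longleftrightarrow> based_algebra.nondegenerate_trace_form (fibre g (alg_one N) s) D"
    by (rule F.discriminant) (rule that)
  have "\<Delta> (of_real t0) \<noteq> 0"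
  proof -
    have t0_in: "complex_of_real t0 \<in> ball 0 c" using t0 by simp
    have "semisimple_algebra (?F t0)"
      by (rule alg_isomorphic_semisimple[OF _ assms(4)]) (use t0(3) in \<open>simp add: specialisation_eq_fibre\<close>)
    then show ?thesis
      using based_algebra.semisimple_imp_nondegenerate_trace_form[OF F.based_algebra_fibre[OF t0_in]]
        \<Delta>_iff[OF t0_in] by simp
  qed
  then have "\<forall>\<^sub>F s in at 0. \<Delta> s \<noteq> 0 \<and> s \<in> ball 0 c"
    using t0 \<open>c > 0\<close> by (intro non_zero_neighbour_alt[OF \<Delta>, of 0 "of_real t0"]) auto
  then obtain \<delta> where \<delta>: "\<delta> > 0" "\<And>s. s \<noteq> 0 \<Longrightarrow> norm s < \<delta> \<Longrightarrow> \<Delta> s \<noteq> 0 \<and> s \<in> ball 0 c"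
    by (auto simp: eventually_at dist_norm)

  \<comment> \<open>The isomorphism type is locally constant on the connected set \<open>(0, \<delta>)\<close>.\<close>
  have fibres_isomorphic: "alg_isomorphic (?F a) (?F b)" if "a \<in> {0<..<\<delta>}" "b \<in> {0<..<\<delta>}" for a b
  proof (rule connected_equivalence_relation[of "{0<..<\<delta>}" a b "\<lambda>a b. alg_isomorphic (?F a) (?F b)"])
    fix s assume s: "s \<in> {0<..<\<delta>}"
    then have s_in: "complex_of_real s \<in> ball 0 c" "\<Delta> (complex_of_real s) \<noteq> 0"
      using \<delta>(2)[of "of_real s"] by auto
    obtain r where r: "r > 0" "ball (complex_of_real s) r \<subseteq> ball 0 c"
      "\<And>z. z \<in> ball (complex_of_real s) r \<Longrightarrow>
         alg_isomorphic (fibre g (alg_one N) (of_real s)) (fibre g (alg_one N) z)"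
      by (rule F.local_triviality[OF s_in(1) \<Delta>_iff[OF s_in(1), THEN iffD1, OF s_in(2)]]) (rule that)
    have "complex_of_real x \<in> ball (complex_of_real s) r" if "x \<in> ball s r" for x
      using that by (simp add: dist_of_real)
    then show "\<exists>T. openin (top_of_set {0<..<\<delta>}) T \<and> s \<in> T \<and> (\<forall>x\<in>T. alg_isomorphic (?F s) (?F x))"
      using r s by (intro exI[of _ "{0<..<\<delta>} \<inter> ball s r"]) (auto intro!: openin_open_Int)
  qed (fact that(1) | fact that(2) | rule connected_Ioo
      | erule (1) alg_isomorphic_trans | erule alg_isomorphic_sym)+

  obtain a where a: "a \<in> {0<..<\<delta>}" "alg_isomorphic (?F a) A"
    by (rule strongly_flat_deformation_nearby[OF assms(6) \<delta>(1)])
      (auto simp: specialisation_eq_fibre)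
  have iso_A: "alg_isomorphic (?F s) A" if "s \<in> {0<..<\<delta>}" for s
    by (rule alg_isomorphic_trans[OF fibres_isomorphic[OF that a(1)] a(2)])
  show ?thesis
  proof (intro conjI exI[of _ \<delta>] allI impI)
    fix s :: real assume s: "0 < s \<and> s < \<delta>"
    then have "s < c" using \<delta>(2)[of "of_real s"] by simp
    with s show "struct_coeffs_converge N D circ (of_real s)" by (intro conv) auto
    show "alg_isomorphic (specialisation N D circ (of_real s)) A"
      using iso_A s by (simp add: specialisation_eq_fibre)
  next
    fix B :: "'b calg"
    assume B: "complex_algebra B \<and> semisimple_algebra B \<and> strongly_flat_deformation N D circ B"
    then have "strongly_flat_deformation N D circ B" by simp
    then obtain b where b: "b \<in> {0<..<\<delta>}" "alg_isomorphic (?F b) B"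
      by (rule strongly_flat_deformation_nearby[OF _ \<delta>(1)]) (auto simp: specialisation_eq_fibre)
    show "alg_isomorphic A B"
      by (rule alg_isomorphic_trans[OF alg_isomorphic_sym[OF iso_A[OF b(1)]] b(2)])
  qed (rule \<delta>(1))
qed

end
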